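(* Let $\Theta$ be a first-order signature and let $\Gamma\cup\{\varphi\}\subseteq For(\Theta)$. If $\Gamma\models_{\mathbf{QLFI1}_\circ}\varphi$ (semantical consequence with respect to first-order twist structures), then $\Gamma\vdash_{\mathbf{QLFI1}_\circ}\varphi$.
   Context: **Language.** $Var$ is a denumerable set of individual variables. A first-order signature $\Theta$ consists of a set of individual constants and, for each $n\ge 1$, sets of function and predicate symbols of arity $n$ (with at least one predicate symbol). Formulas are built with binary connectives $\wedge,\vee,\to$, unary connectives $\neg,\circ$, and quantifiers $\forall,\exists$. $For(\Theta)$, $Sen(\Theta)$ are the sets of formulas and sentences. $\varphi[x/t]$ is the result of replacing every free occurrence of $x$ in $\varphi$ by $t$. $\alpha\leftrightarrow\beta$ abbreviates $(\alpha\to\beta)\wedge(\beta\to\alpha)$. **Calculus $\mathbf{QLFI1}_\circ$** (Hilbert calculus over $For(\Theta)$). Axiom schemas: (A1) $\alpha\to(\beta\to\alpha)$; (A2) $(\alpha\to(\beta\to\gamma))\to((\alpha\to\beta)\to(\alpha\to\gamma))$; (A3) $\alpha\to(\beta\to(\alpha\wedge\beta))$; (A4) $(\alpha\wedge\beta)\to\alpha$; (A5) $(\alpha\wedge\beta)\to\beta$; (A6) $\alpha\to(\alpha\vee\beta)$; (A7) $\beta\to(\alpha\vee\beta)$; (A8) $(\alpha\to\gamma)\to((\beta\to\gamma)\to((\alpha\vee\beta)\to\gamma))$; (A9) $\alpha\vee(\alpha\to\beta)$; (A10) $\alpha\vee\neg\alpha$; (A11) $\circ\alpha\to(\alpha\to(\neg\alpha\to\beta))$;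 (ci) $\neg\circ\alpha\to(\alpha\wedge\neg\alpha)$; (dneg) $\neg\neg\alpha\leftrightarrow\alpha$; (neg$\vee$) $\neg(\alpha\vee\beta)\leftrightarrow(\neg\alpha\wedge\neg\beta)$; (neg$\wedge$) $\neg(\alpha\wedge\beta)\leftrightarrow(\neg\alpha\vee\neg\beta)$; (neg$\to$) $\neg(\alpha\to\beta)\leftrightarrow(\alpha\wedge\neg\beta)$; (Ax12) $\varphi[x/t]\to\exists x\varphi$ if $t$ is free for $x$ in $\varphi$; (Ax13) $\forall x\varphi\to\varphi[x/t]$ if $t$ is free for $x$ in $\varphi$; (Ax$\neg\exists$) $\neg\exists x\varphi\leftrightarrow\forall x\neg\varphi$; (Ax$\neg\forall$) $\neg\forall x\varphi\leftrightarrow\exists x\neg\varphi$. Rules: (MP) from $\alpha$, $\alpha\to\beta$ infer $\beta$; ($\exists$-In) from $\varphi\to\psi$ infer $\exists x\varphi\to\psi$ if $x$ is not free in $\psi$; ($\forall$-In) from $\varphi\to\psi$ infer $\varphi\to\forall x\psi$ if $x$ is not free in $\varphi$. $\Gamma\vdash_{\mathbf{QLFI1}_\circ}\varphi$ means there is a finite derivation of $\varphi$ whose steps are axiom instances, members of $\Gamma$, or follow from earlier steps by a rule. **Twist structures.** For a Boolean algebra $\mathcal A$ with domain $A$, let $T_{\mathcal A}=\{(z_1,z_2)\in A\times A: z_1\vee z_2=1\}$. The twist structure $\mathcal T_{\mathcal A}$ is the algebra on $T_{\mathcal A}$ with operations $(z_1,z_2)\tilde\wedge(w_1,w_2)=(z_1\wedge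 w_1,z_2\vee w_2)$; $(z_1,z_2)\tilde\vee(w_1,w_2)=(z_1\vee w_1,z_2\wedge w_2)$; $(z_1,z_2)\tilde\to(w_1,w_2)=(z_1\to w_1,z_1\wedge w_2)$; $\tilde\neg(z_1,z_2)=(z_2,z_1)$; $\tilde\circ(z_1,z_2)=({\sim}(z_1\wedge z_2),z_1\wedge z_2)$, where ${\sim}$ is Boolean complement. The associated matrix is $\mathcal{MT}_{\mathcal A}=\langle\mathcal T_{\mathcal A},D_{\mathcal A}\rangle$ with $D_{\mathcal A}=\{(z_1,z_2)\in T_{\mathcal A}: z_1=1\}$. **Structures and interpretation.** Let $\mathcal A$ be a complete Boolean algebra. A structure $\mathfrak A=\langle U,I_{\mathfrak A}\rangle$ over $\mathcal{MT}_{\mathcal A}$ and $\Theta$ has a nonempty domain $U$ and assigns $c^{\mathfrak A}\in U$ to constants, $f^{\mathfrak A}:U^n\to U$ to $n$-ary function symbols, $P^{\mathfrak A}:U^n\to T_{\mathcal A}$ to $n$-ary predicate symbols. $\Theta_U$ is $\Theta$ plus a new constant $\bar a$ for each $a\in U$; $\widehat{\mathfrak A}$ extends $\mathfrak A$ by interpreting $\bar a$ as $a$; $[\![t]\!]^{\widehat{\mathfrak A}}$ is the usual value of a closed term $t$. The interpretation map $[\![\cdot]\!]^{\mathfrak A}:Sen(\Theta_U)\to T_{\mathcal A}$ is defined by: $[\![P(t_1,\dots,t_n)]\!]^{\mathfrak A}=P^{\mathfrak A}([\![t_1]\!]^{\widehat{\mathfrak A}},\dots,[\![t_n]\!]^{\widehat{\mathfrak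 A}})$; $[\![\#\varphi]\!]^{\mathfrak A}=\tilde\#[\![\varphi]\!]^{\mathfrak A}$ for $\#\in\{\neg,\circ\}$; $[\![\varphi\#\psi]\!]^{\mathfrak A}=[\![\varphi]\!]^{\mathfrak A}\tilde\#[\![\psi]\!]^{\mathfrak A}$ for $\#\in\{\wedge,\vee,\to\}$; $[\![\forall x\varphi]\!]^{\mathfrak A}=\big(\bigwedge_{a\in U}([\![\varphi[x/\bar a]]\!]^{\mathfrak A})_1,\bigvee_{a\in U}([\![\varphi[x/\bar a]]\!]^{\mathfrak A})_2\big)$; $[\![\exists x\varphi]\!]^{\mathfrak A}=\big(\bigvee_{a\in U}([\![\varphi[x/\bar a]]\!]^{\mathfrak A})_1,\bigwedge_{a\in U}([\![\varphi[x/\bar a]]\!]^{\mathfrak A})_2\big)$. For an assignment $\mu:Var\to U$, $[\![\varphi]\!]^{\mathfrak A}_\mu=[\![\widehat\mu(\varphi)]\!]^{\mathfrak A}$, where $\widehat\mu(\varphi)$ replaces each free variable $x$ of $\varphi$ by $\overline{\mu(x)}$. **Consequence.** $\Gamma\models_{(\mathfrak A,\mathcal{MT}_{\mathcal A})}\varphi$ iff: if $[\![\gamma]\!]^{\mathfrak A}_\mu\in D_{\mathcal A}$ for all $\gamma\in\Gamma$ and all $\mu$, then $[\![\varphi]\!]^{\mathfrak A}_\mu\in D_{\mathcal A}$ for all $\mu$. $\Gamma\models_{\mathbf{QLFI1}_\circ}\varphi$ iff $\Gamma\models_{(\mathfrak A,\mathcal{MT}_{\mathcal A})}\varphi$ for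 every complete Boolean algebra $\mathcal A$ and every structure $\mathfrak A$ over $\mathcal{MT}_{\mathcal A}$ and $\Theta$. *)

theory Defs
  imports "HOL-Algebra.Complete_Lattice"
begin

section \<open>Language\<close>

datatype ('c, 'f) tm =
    Var nat
  | Cst 'c
  | Fn 'f "('c, 'f) tm list"

datatype ('c, 'f, 'p) fm =
    Pred 'p "('c, 'f) tm list"
  | And "('c, 'f, 'p) fm" "('c, 'f, 'p) fm"
  | Or "('c, 'f, 'p) fm" "('c, 'f, 'p) fm"
  | Imp "('c, 'f, 'p) fm" "('c, 'f, 'p) fm"
  | Neg "('c, 'f, 'p) fm"
  | Circ "('c, 'f, 'p) fm"
  | All nat "('c, 'f, 'p) fm"
  | Ex nat "('c, 'f, 'p) fm"

abbreviation Iff :: "('c, 'f, 'p) fm \<Rightarrow> ('c, 'f, 'p) fm \<Rightarrow> ('c, 'f, 'p) fm" where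
  "Iff \<alpha> \<beta> \<equiv> And (Imp \<alpha> \<beta>) (Imp \<beta> \<alpha>)"

text \<open>Only the arities \<open>n \<ge> 1\<close> of \<open>Funs\<close> and \<open>Preds\<close> matter: \<open>wf_tm\<close> and \<open>wf_fm\<close> below
  require nonempty argument lists.\<close>

record ('c, 'f, 'p) signature =
  Consts :: "'c set"
  Funs :: "nat \<Rightarrow> 'f set"
  Preds :: "nat \<Rightarrow> 'p set"

definition is_signature :: "('c, 'f, 'p) signature \<Rightarrow> bool" where
  "is_signature \<Theta> \<longleftrightarrow> (\<exists>n\<ge>1. Preds \<Theta> n \<noteq> {})"

primrec wf_tm :: "('c, 'f, 'p) signature \<Rightarrow> ('c, 'f) tm \<Rightarrow> bool" where
  "wf_tm \<Theta> (Var x) \<longleftrightarrow> True"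
| "wf_tm \<Theta> (Cst c) \<longleftrightarrow> c \<in> Consts \<Theta>"
| "wf_tm \<Theta> (Fn f ts) \<longleftrightarrow> ts \<noteq> [] \<and> f \<in> Funs \<Theta> (length ts) \<and> list_all (wf_tm \<Theta>) ts"

primrec wf_fm :: "('c, 'f, 'p) signature \<Rightarrow> ('c, 'f, 'p) fm \<Rightarrow> bool" where
  "wf_fm \<Theta> (Pred P ts) \<longleftrightarrow> ts \<noteq> [] \<and> P \<in> Preds \<Theta> (length ts) \<and> list_all (wf_tm \<Theta>) ts"
| "wf_fm \<Theta> (And \<phi> \<psi>) \<longleftrightarrow> wf_fm \<Theta> \<phi> \<and> wf_fm \<Theta> \<psi>"
| "wf_fm \<Theta> (Or \<phi> \<psi>) \<longleftrightarrow> wf_fm \<Theta> \<phi> \<and> wf_fm \<Theta> \<psi>"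
| "wf_fm \<Theta> (Imp \<phi> \<psi>) \<longleftrightarrow> wf_fm \<Theta> \<phi> \<and> wf_fm \<Theta> \<psi>"
| "wf_fm \<Theta> (Neg \<phi>) \<longleftrightarrow> wf_fm \<Theta> \<phi>"
| "wf_fm \<Theta> (Circ \<phi>) \<longleftrightarrow> wf_fm \<Theta> \<phi>"
| "wf_fm \<Theta> (All x \<phi>) \<longleftrightarrow> wf_fm \<Theta> \<phi>"
| "wf_fm \<Theta> (Ex x \<phi>) \<longleftrightarrow> wf_fm \<Theta> \<phi>"

definition For :: "('c, 'f, 'p) signature \<Rightarrow> ('c, 'f, 'p) fm set" where
  "For \<Theta> = {\<phi>. wf_fm \<Theta> \<phi>}"

primrec fv_tm :: "('c, 'f) tm \<Rightarrow> nat set" where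
  "fv_tm (Var x) = {x}"
| "fv_tm (Cst c) = {}"
| "fv_tm (Fn f ts) = \<Union> (set (map fv_tm ts))"

primrec fv :: "('c, 'f, 'p) fm \<Rightarrow> nat set" where
  "fv (Pred P ts) = \<Union> (set (map fv_tm ts))"
| "fv (And \<phi> \<psi>) = fv \<phi> \<union> fv \<psi>"
| "fv (Or \<phi> \<psi>) = fv \<phi> \<union> fv \<psi>"
| "fv (Imp \<phi> \<psi>) = fv \<phi> \<union> fv \<psi>"
| "fv (Neg \<phi>) = fv \<phi>"
| "fv (Circ \<phi>) = fv \<phi>"
| "fv (All x \<phi>) = fv \<phi> - {x}"
| "fv (Ex x \<phi>) = fv \<phi> - {x}"

text \<open>Simultaneous replacement of the free variables. Bound variables are not renamed, so it may
  capture; the quantifier axioms exclude capture by the side condition \<open>free_for\<close>.\<close>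

primrec subst_tm :: "(nat \<Rightarrow> ('c, 'f) tm) \<Rightarrow> ('c, 'f) tm \<Rightarrow> ('c, 'f) tm" where
  "subst_tm \<sigma> (Var x) = \<sigma> x"
| "subst_tm \<sigma> (Cst c) = Cst c"
| "subst_tm \<sigma> (Fn f ts) = Fn f (map (subst_tm \<sigma>) ts)"

primrec subst_fm :: "(nat \<Rightarrow> ('c, 'f) tm) \<Rightarrow> ('c, 'f, 'p) fm \<Rightarrow> ('c, 'f, 'p) fm" where
  "subst_fm \<sigma> (Pred P ts) = Pred P (map (subst_tm \<sigma>) ts)"
| "subst_fm \<sigma> (And \<phi> \<psi>) = And (subst_fm \<sigma> \<phi>) (subst_fm \<sigma> \<psi>)"
| "subst_fm \<sigma> (Or \<phi> \<psi>) = Or (subst_fm \<sigma> \<phi>) (subst_fm \<sigma> \<psi>)"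
| "subst_fm \<sigma> (Imp \<phi> \<psi>) = Imp (subst_fm \<sigma> \<phi>) (subst_fm \<sigma> \<psi>)"
| "subst_fm \<sigma> (Neg \<phi>) = Neg (subst_fm \<sigma> \<phi>)"
| "subst_fm \<sigma> (Circ \<phi>) = Circ (subst_fm \<sigma> \<phi>)"
| "subst_fm \<sigma> (All x \<phi>) = All x (subst_fm (\<sigma>(x := Var x)) \<phi>)"
| "subst_fm \<sigma> (Ex x \<phi>) = Ex x (subst_fm (\<sigma>(x := Var x)) \<phi>)"

definition subst1 :: "('c, 'f, 'p) fm \<Rightarrow> nat \<Rightarrow> ('c, 'f) tm \<Rightarrow> ('c, 'f, 'p) fm" where
  "subst1 \<phi> x t = subst_fm (Var(x := t)) \<phi>"

primrec free_for :: "('c, 'f) tm \<Rightarrow> nat \<Rightarrow> ('c, 'f, 'p) fm \<Rightarrow> bool" where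
  "free_for t x (Pred P ts) \<longleftrightarrow> True"
| "free_for t x (And \<phi> \<psi>) \<longleftrightarrow> free_for t x \<phi> \<and> free_for t x \<psi>"
| "free_for t x (Or \<phi> \<psi>) \<longleftrightarrow> free_for t x \<phi> \<and> free_for t x \<psi>"
| "free_for t x (Imp \<phi> \<psi>) \<longleftrightarrow> free_for t x \<phi> \<and> free_for t x \<psi>"
| "free_for t x (Neg \<phi>) \<longleftrightarrow> free_for t x \<phi>"
| "free_for t x (Circ \<phi>) \<longleftrightarrow> free_for t x \<phi>"
| "free_for t x (All y \<phi>) \<longleftrightarrow> x \<notin> fv (All y \<phi>) \<or> (y \<notin> fv_tm t \<and> free_for t x \<phi>)"
| "free_for t x (Ex y \<phi>) \<longleftrightarrow> x \<notin> fv (Ex y \<phi>) \<or> (y \<notin> fv_tm t \<and> free_for t x \<phi>)"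


section \<open>The Hilbert calculus\<close>

inductive ax :: "('c, 'f, 'p) fm \<Rightarrow> bool" where
  A1: "ax (Imp \<alpha> (Imp \<beta> \<alpha>))"
| A2: "ax (Imp (Imp \<alpha> (Imp \<beta> \<gamma>)) (Imp (Imp \<alpha> \<beta>) (Imp \<alpha> \<gamma>)))"
| A3: "ax (Imp \<alpha> (Imp \<beta> (And \<alpha> \<beta>)))"
| A4: "ax (Imp (And \<alpha> \<beta>) \<alpha>)"
| A5: "ax (Imp (And \<alpha> \<beta>) \<beta>)"
| A6: "ax (Imp \<alpha> (Or \<alpha> \<beta>))"
| A7: "ax (Imp \<beta> (Or \<alpha> \<beta>))"
| A8: "ax (Imp (Imp \<alpha> \<gamma>) (Imp (Imp \<beta> \<gamma>) (Imp (Or \<alpha> \<beta>) \<gamma>)))"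
| A9: "ax (Or \<alpha> (Imp \<alpha> \<beta>))"
| A10: "ax (Or \<alpha> (Neg \<alpha>))"
| A11: "ax (Imp (Circ \<alpha>) (Imp \<alpha> (Imp (Neg \<alpha>) \<beta>)))"
| ci: "ax (Imp (Neg (Circ \<alpha>)) (And \<alpha> (Neg \<alpha>)))"
| dneg: "ax (Iff (Neg (Neg \<alpha>)) \<alpha>)"
| neg_Or: "ax (Iff (Neg (Or \<alpha> \<beta>)) (And (Neg \<alpha>) (Neg \<beta>)))"
| neg_And: "ax (Iff (Neg (And \<alpha> \<beta>)) (Or (Neg \<alpha>) (Neg \<beta>)))"
| neg_Imp: "ax (Iff (Neg (Imp \<alpha> \<beta>)) (And \<alpha> (Neg \<beta>)))"
| Ax12: "free_for t x \<phi> \<Longrightarrow> ax (Imp (subst1 \<phi> x t) (Ex x \<phi>))"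
| Ax13: "free_for t x \<phi> \<Longrightarrow> ax (Imp (All x \<phi>) (subst1 \<phi> x t))"
| Ax_neg_Ex: "ax (Iff (Neg (Ex x \<phi>)) (All x (Neg \<phi>)))"
| Ax_neg_All: "ax (Iff (Neg (All x \<phi>)) (Ex x (Neg \<phi>)))"

inductive derives :: "('c, 'f, 'p) signature \<Rightarrow> ('c, 'f, 'p) fm set \<Rightarrow> ('c, 'f, 'p) fm \<Rightarrow> bool"
  for \<Theta> :: "('c, 'f, 'p) signature" and \<Gamma> :: "('c, 'f, 'p) fm set" where
  Axiom: "ax \<phi> \<Longrightarrow> \<phi> \<in> For \<Theta> \<Longrightarrow> derives \<Theta> \<Gamma> \<phi>"
| Premise: "\<phi> \<in> \<Gamma> \<Longrightarrow> derives \<Theta> \<Gamma> \<phi>"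
| MP: "derives \<Theta> \<Gamma> \<alpha> \<Longrightarrow> derives \<Theta> \<Gamma> (Imp \<alpha> \<beta>) \<Longrightarrow> derives \<Theta> \<Gamma> \<beta>"
| Ex_In: "derives \<Theta> \<Gamma> (Imp \<phi> \<psi>) \<Longrightarrow> x \<notin> fv \<psi> \<Longrightarrow> derives \<Theta> \<Gamma> (Imp (Ex x \<phi>) \<psi>)"
| All_In: "derives \<Theta> \<Gamma> (Imp \<phi> \<psi>) \<Longrightarrow> x \<notin> fv \<phi> \<Longrightarrow> derives \<Theta> \<Gamma> (Imp \<phi> (All x \<psi>))"


section \<open>Complete Boolean algebras and twist structures\<close>

text \<open>Algebras have an explicit carrier, because semantical consequence quantifies over all of
  them.\<close>

definition is_compl :: "'b gorder \<Rightarrow> 'b \<Rightarrow> 'b \<Rightarrow> bool" where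
  "is_compl A x y \<longleftrightarrow> y \<in> carrier A \<and> x \<sqinter>\<^bsub>A\<^esub> y = \<bottom>\<^bsub>A\<^esub> \<and> x \<squnion>\<^bsub>A\<^esub> y = \<top>\<^bsub>A\<^esub>"

definition complete_boolean :: "'b gorder \<Rightarrow> bool" where
  "complete_boolean A \<longleftrightarrow> complete_lattice A \<and>
     (\<forall>x\<in>carrier A. \<forall>y\<in>carrier A. \<forall>z\<in>carrier A.
        x \<sqinter>\<^bsub>A\<^esub> (y \<squnion>\<^bsub>A\<^esub> z) = (x \<sqinter>\<^bsub>A\<^esub> y) \<squnion>\<^bsub>A\<^esub> (x \<sqinter>\<^bsub>A\<^esub> z)) \<and>
     (\<forall>x\<in>carrier A. \<exists>y. is_compl A x y)"

definition compl :: "'b gorder \<Rightarrow> 'b \<Rightarrow> 'b" where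
  "compl A x = (THE y. is_compl A x y)"

definition bimp :: "'b gorder \<Rightarrow> 'b \<Rightarrow> 'b \<Rightarrow> 'b" where
  "bimp A x y = compl A x \<squnion>\<^bsub>A\<^esub> y"

definition twist :: "'b gorder \<Rightarrow> ('b \<times> 'b) set" where
  "twist A = {(z1, z2). z1 \<in> carrier A \<and> z2 \<in> carrier A \<and> z1 \<squnion>\<^bsub>A\<^esub> z2 = \<top>\<^bsub>A\<^esub>}"

definition designated :: "'b gorder \<Rightarrow> ('b \<times> 'b) set" where
  "designated A = {(z1, z2). (z1, z2) \<in> twist A \<and> z1 = \<top>\<^bsub>A\<^esub>}"

fun tw_and :: "'b gorder \<Rightarrow> 'b \<times> 'b \<Rightarrow> 'b \<times> 'b \<Rightarrow> 'b \<times> 'b" where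
  "tw_and A (z1, z2) (w1, w2) = (z1 \<sqinter>\<^bsub>A\<^esub> w1, z2 \<squnion>\<^bsub>A\<^esub> w2)"

fun tw_or :: "'b gorder \<Rightarrow> 'b \<times> 'b \<Rightarrow> 'b \<times> 'b \<Rightarrow> 'b \<times> 'b" where
  "tw_or A (z1, z2) (w1, w2) = (z1 \<squnion>\<^bsub>A\<^esub> w1, z2 \<sqinter>\<^bsub>A\<^esub> w2)"

fun tw_imp :: "'b gorder \<Rightarrow> 'b \<times> 'b \<Rightarrow> 'b \<times> 'b \<Rightarrow> 'b \<times> 'b" where
  "tw_imp A (z1, z2) (w1, w2) = (bimp A z1 w1, z1 \<sqinter>\<^bsub>A\<^esub> w2)"

fun tw_neg :: "'b gorder \<Rightarrow> 'b \<times> 'b \<Rightarrow> 'b \<times> 'b" where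
  "tw_neg A (z1, z2) = (z2, z1)"

fun tw_circ :: "'b gorder \<Rightarrow> 'b \<times> 'b \<Rightarrow> 'b \<times> 'b" where
  "tw_circ A (z1, z2) = (compl A (z1 \<sqinter>\<^bsub>A\<^esub> z2), z1 \<sqinter>\<^bsub>A\<^esub> z2)"


section \<open>Structures and interpretation\<close>

record ('c, 'f, 'p, 'u, 'b) struct =
  dom :: "'u set"
  cst :: "'c \<Rightarrow> 'u"
  fn :: "'f \<Rightarrow> 'u list \<Rightarrow> 'u"
  prd :: "'p \<Rightarrow> 'u list \<Rightarrow> 'b \<times> 'b"

definition is_struct ::
  "'b gorder \<Rightarrow> ('c, 'f, 'p) signature \<Rightarrow> ('c, 'f, 'p, 'u, 'b) struct \<Rightarrow> bool" where
  "is_struct A \<Theta> M \<longleftrightarrow>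
     dom M \<noteq> {} \<and>
     (\<forall>c\<in>Consts \<Theta>. cst M c \<in> dom M) \<and>
     (\<forall>us\<in>lists (dom M). us \<noteq> [] \<longrightarrow>
        (\<forall>f\<in>Funs \<Theta> (length us). fn M f us \<in> dom M) \<and>
        (\<forall>P\<in>Preds \<Theta> (length us). prd M P us \<in> twist A))"

text \<open>The language over \<open>\<Theta>\<^sub>U\<close> has constants of type \<open>'c + 'u\<close>: \<open>Inl c\<close> is a constant of
  \<open>\<Theta>\<close> and \<open>Inr a\<close> is the new constant naming \<open>a\<close>. Only closed terms are
  evaluated, so the value of a variable is irrelevant.\<close>

primrec tval :: "('c, 'f, 'p, 'u, 'b) struct \<Rightarrow> ('c + 'u, 'f) tm \<Rightarrow> 'u" where
  "tval M (Var x) = undefined"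
| "tval M (Cst d) = (case d of Inl c \<Rightarrow> cst M c | Inr a \<Rightarrow> a)"
| "tval M (Fn f ts) = fn M f (map (tval M) ts)"

primrec connectives :: "('c, 'f, 'p) fm \<Rightarrow> nat" where
  "connectives (Pred P ts) = 0"
| "connectives (And \<phi> \<psi>) = Suc (connectives \<phi> + connectives \<psi>)"
| "connectives (Or \<phi> \<psi>) = Suc (connectives \<phi> + connectives \<psi>)"
| "connectives (Imp \<phi> \<psi>) = Suc (connectives \<phi> + connectives \<psi>)"
| "connectives (Neg \<phi>) = Suc (connectives \<phi>)"
| "connectives (Circ \<phi>) = Suc (connectives \<phi>)"
| "connectives (All x \<phi>) = Suc (connectives \<phi>)"
| "connectives (Ex x \<phi>) = Suc (connectives \<phi>)"

lemma connectives_subst_fm [simp]: "connectives (subst_fm \<sigma> \<phi>) = connectives \<phi>"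
  by (induction \<phi> arbitrary: \<sigma>) simp_all

lemma connectives_subst1 [simp]: "connectives (subst1 \<phi> x t) = connectives \<phi>"
  by (simp add: subst1_def)

text \<open>Meaningful on sentences over \<open>\<Theta>\<^sub>U\<close>, and used on sentences only.\<close>

function interp :: "'b gorder \<Rightarrow> ('c, 'f, 'p, 'u, 'b) struct \<Rightarrow> ('c + 'u, 'f, 'p) fm \<Rightarrow> 'b \<times> 'b"
where
  "interp A M (Pred P ts) = prd M P (map (tval M) ts)"
| "interp A M (And \<phi> \<psi>) = tw_and A (interp A M \<phi>) (interp A M \<psi>)"
| "interp A M (Or \<phi> \<psi>) = tw_or A (interp A M \<phi>) (interp A M \<psi>)"
| "interp A M (Imp \<phi> \<psi>) = tw_imp A (interp A M \<phi>) (interp A M \<psi>)"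
| "interp A M (Neg \<phi>) = tw_neg A (interp A M \<phi>)"
| "interp A M (Circ \<phi>) = tw_circ A (interp A M \<phi>)"
| "interp A M (All x \<phi>) =
     (\<Sqinter>\<^bsub>A\<^esub> ((\<lambda>a. fst (interp A M (subst1 \<phi> x (Cst (Inr a))))) ` dom M),
      \<Squnion>\<^bsub>A\<^esub> ((\<lambda>a. snd (interp A M (subst1 \<phi> x (Cst (Inr a))))) ` dom M))"
| "interp A M (Ex x \<phi>) =
     (\<Squnion>\<^bsub>A\<^esub> ((\<lambda>a. fst (interp A M (subst1 \<phi> x (Cst (Inr a))))) ` dom M),
      \<Sqinter>\<^bsub>A\<^esub> ((\<lambda>a. snd (interp A M (subst1 \<phi> x (Cst (Inr a))))) ` dom M))"
  by pat_completeness auto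
termination
  by (relation "Wellfounded.measure (\<lambda>(A, M, \<phi>). connectives \<phi>)") auto

definition ground :: "(nat \<Rightarrow> 'u) \<Rightarrow> ('c, 'f, 'p) fm \<Rightarrow> ('c + 'u, 'f, 'p) fm" where
  "ground \<mu> \<phi> = subst_fm (\<lambda>x. Cst (Inr (\<mu> x))) (map_fm Inl id id \<phi>)"


section \<open>Semantical consequence\<close>

definition holds_in ::
  "'b gorder \<Rightarrow> ('c, 'f, 'p, 'u, 'b) struct \<Rightarrow> ('c, 'f, 'p) fm \<Rightarrow> bool" where
  "holds_in A M \<phi> \<longleftrightarrow> (\<forall>\<mu>. range \<mu> \<subseteq> dom M \<longrightarrow> interp A M (ground \<mu> \<phi>) \<in> designated A)"

definition entails_in ::
  "'b gorder \<Rightarrow> ('c, 'f, 'p, 'u, 'b) struct \<Rightarrow> ('c, 'f, 'p) fm set \<Rightarrow> ('c, 'f, 'p) fm \<Rightarrow> bool" where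
  "entails_in A M \<Gamma> \<phi> \<longleftrightarrow> ((\<forall>\<gamma>\<in>\<Gamma>. holds_in A M \<gamma>) \<longrightarrow> holds_in A M \<phi>)"

text \<open>HOL cannot quantify over types inside a formula, so the universes from which domains
  (\<open>'u\<close>) and algebras (\<open>'b\<close>) are taken are parameters: all carriers within them are
  considered. Over small universes this relation is coarser than the intended one (on a one-element
  \<open>'b\<close>, say, only the degenerate algebra is left). It is therefore to be used on types of
  the form \<open>'u + ('c, 'f, 'p) fm\<close> and \<open>'b + ('c, 'f, 'p) fm set\<close>, with \<open>'u\<close> and
  \<open>'b\<close> arbitrary: these are at least as large as the language (respectively its power set),
  and as large as one likes.\<close>

definition entails ::
  "'u itself \<Rightarrow> 'b itself \<Rightarrow> ('c, 'f, 'p) signature \<Rightarrow> ('c, 'f, 'p) fm set \<Rightarrow> ('c, 'f, 'p) fm \<Rightarrow> bool"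
where
  "entails TYPE('u) TYPE('b) \<Theta> \<Gamma> \<phi> \<longleftrightarrow>
     (\<forall>(A :: 'b gorder) (M :: ('c, 'f, 'p, 'u, 'b) struct).
        complete_boolean A \<longrightarrow> is_struct A \<Theta> M \<longrightarrow> entails_in A M \<Gamma> \<phi>)"

end

(* A Lindenbaum construction in the style of Rasiowa and Sikorski. The formulas,
   preordered by provability of the implication from Gamma, form a Boolean preorder, since A9 makes
   the positive fragment classical and A11 provides a bottom formula. Its MacNeille completion is a
   complete Boolean algebra that preserves all existing infima and suprema. Let the terms be the
   individuals and let a formula alpha have as value the pair of the classes of alpha and of its
   negation; the negation axioms say that this is a homomorphism into the twist structure. The class
   of a universal formula is the infimum of the classes of its instances, because an instance at a
   variable that is not free in a lower bound can be generalized; so no Henkin constants are needed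
   and the language may have any cardinality. The formulas valid in this structure are then exactly
   those derivable from Gamma. *)

theory Submission
  imports Defs
begin

section \<open>The MacNeille completion of a Boolean preorder\<close>

text \<open>The obstacle is substitution. The domain contains all terms, open ones included, so an
  assignment is a substitution, and the value of a quantified formula involves its instances at
  every term, whereas \<open>Ax12\<close> and \<open>Ax13\<close> supply only instances without
  capture. Formulas are therefore evaluated after a substitution \<open>csubst\<close> that renames
  all binders, and most of the syntactic work shows that the choice of new names is immaterial.
  Since provable equivalence may be lost under \<open>Neg\<close>, this has to be shown for a
  formula and its negation together.

  The completion consists of the sets that equal their double orthogonal, where two elements are
  orthogonal if their meet is below \<open>falsum\<close>. In a Boolean preorder these are the
  MacNeille cuts, and the complement of such a set is simply its orthogonal. The cuts are taken in
  the preorder itself and no quotient is formed: equivalent elements have the same down-set.\<close>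

locale boolean_preorder =
  fixes P :: "'a set"
    and leq :: "'a \<Rightarrow> 'a \<Rightarrow> bool" (infix \<open>\<preceq>\<close> 50)
    and conj :: "'a \<Rightarrow> 'a \<Rightarrow> 'a" (infixl \<open>\<odot>\<close> 70)
    and falsum :: 'a
    and cneg :: "'a \<Rightarrow> 'a"
    and emb :: "'a set \<Rightarrow> 'd"
  assumes conj_in [simp]: "a \<in> P \<Longrightarrow> b \<in> P \<Longrightarrow> a \<odot> b \<in> P"
    and falsum_in [simp]: "falsum \<in> P"
    and cneg_in [simp]: "a \<in> P \<Longrightarrow> cneg a \<in> P"
    and leq_refl [simp]: "a \<in> P \<Longrightarrow> a \<preceq> a"
    and leq_trans: "a \<preceq> b \<Longrightarrow> b \<preceq> c \<Longrightarrow> a \<preceq> c"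
    and conj_leq1: "a \<in> P \<Longrightarrow> b \<in> P \<Longrightarrow> a \<odot> b \<preceq> a"
    and conj_leq2: "a \<in> P \<Longrightarrow> b \<in> P \<Longrightarrow> a \<odot> b \<preceq> b"
    and leq_conj: "c \<preceq> a \<Longrightarrow> c \<preceq> b \<Longrightarrow> c \<preceq> a \<odot> b"
    and falsum_leq: "a \<in> P \<Longrightarrow> falsum \<preceq> a"
    and leq_cneg: "a \<in> P \<Longrightarrow> b \<in> P \<Longrightarrow> a \<preceq> cneg b \<longleftrightarrow> a \<odot> b \<preceq> falsum"
    and cneg_cneg: "a \<in> P \<Longrightarrow> cneg (cneg a) \<preceq> a"
    and inj_emb: "inj emb"
begin

text \<open>Orthogonal to \<open>a\<close> means below \<open>cneg a\<close>. Hence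
  \<open>perp X\<close> collects the lower bounds of the complements of X, and
  \<open>perp (perp X)\<close> the lower bounds of the upper bounds of X.\<close>

definition perp :: "'a set \<Rightarrow> 'a set" where
  "perp X = {b \<in> P. \<forall>a\<in>X. b \<odot> a \<preceq> falsum}"

definition closed :: "'a set \<Rightarrow> bool" where
  "closed X \<longleftrightarrow> perp (perp X) = X"

text \<open>The order is inclusion, transported along the injection \<open>emb\<close> into a type
  that may be larger than the power set.\<close>

definition completion :: "'d gorder" where
  "completion = \<lparr>carrier = emb ` Collect closed, eq = (=), le = (\<lambda>x y. inv emb x \<subseteq> inv emb y)\<rparr>"

definition principal :: "'a \<Rightarrow> 'd" where
  "principal a = emb {b \<in> P. b \<preceq> a}"

section \<open>Orthogonality as a Galois connection\<close>

lemma conj_mono: "a \<in> P \<Longrightarrow> b \<in> P \<Longrightarrow> a \<preceq> c \<Longrightarrow> b \<preceq> d \<Longrightarrow> a \<odot> b \<preceq> c \<odot> d"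
  by (meson conj_leq1 conj_leq2 leq_conj leq_trans)

lemma conj_commute: "a \<in> P \<Longrightarrow> b \<in> P \<Longrightarrow> a \<odot> b \<preceq> b \<odot> a"
  by (simp add: conj_leq1 conj_leq2 leq_conj)

lemma orth_commute: "a \<in> P \<Longrightarrow> b \<in> P \<Longrightarrow> a \<odot> b \<preceq> falsum \<longleftrightarrow> b \<odot> a \<preceq> falsum"
  by (meson conj_commute leq_trans)

lemma leq_cneg_commute: "a \<in> P \<Longrightarrow> b \<in> P \<Longrightarrow> a \<preceq> cneg b \<longleftrightarrow> b \<preceq> cneg a"
  by (simp add: leq_cneg orth_commute[of a b])

lemma orth_self: "a \<in> P \<Longrightarrow> a \<odot> a \<preceq> falsum \<Longrightarrow> a \<preceq> falsum"
  using leq_trans[OF leq_conj[of a a a]] leq_refl by simp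

lemma perp_subset: "perp X \<subseteq> P"
  by (auto simp: perp_def)

lemma perp_down: "b \<in> perp X \<Longrightarrow> X \<subseteq> P \<Longrightarrow> a \<in> P \<Longrightarrow> a \<preceq> b \<Longrightarrow> a \<in> perp X"
  unfolding perp_def
  by (blast intro: leq_refl leq_trans[OF conj_mono[of a c b c for c]])

lemma perp_antimono: "X \<subseteq> Y \<Longrightarrow> perp Y \<subseteq> perp X"
  by (auto simp: perp_def)

text \<open>Both sides say that every element of X is orthogonal to every element of Y. This
  symmetry makes \<open>perp\<close> a Galois connection of the power set with itself.\<close>

lemma subset_perp_iff: "X \<subseteq> P \<Longrightarrow> Y \<subseteq> P \<Longrightarrow> X \<subseteq> perp Y \<longleftrightarrow> Y \<subseteq> perp X"
  unfolding perp_def using orth_commute by blast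

lemma perp_perp_extensive: "X \<subseteq> P \<Longrightarrow> X \<subseteq> perp (perp X)"
  using subset_perp_iff[of X "perp X"] perp_subset by blast

lemma closed_perp: "X \<subseteq> P \<Longrightarrow> closed (perp X)"
  unfolding closed_def
  by (meson perp_antimono perp_perp_extensive perp_subset subset_antisym)

lemma closed_subset: "closed X \<Longrightarrow> X \<subseteq> P"
  unfolding closed_def using perp_subset by blast

lemma closed_down: "closed X \<Longrightarrow> b \<in> X \<Longrightarrow> a \<in> P \<Longrightarrow> a \<preceq> b \<Longrightarrow> a \<in> X"
  by (metis closed_def perp_down perp_subset)

lemma falsum_in_closed: "closed X \<Longrightarrow> falsum \<in> X"
  unfolding closed_def perp_def
  using conj_leq1 falsum_in by blast

lemma closed_hull_least: "X \<subseteq> Y \<Longrightarrow> closed Y \<Longrightarrow> perp (perp X) \<subseteq> Y"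
  by (metis closed_def perp_antimono)

text \<open>Intersecting with P matters for the empty family, whose infimum is the top element
  P.\<close>

lemma closed_Inter:
  assumes "\<And>X. X \<in> \<X> \<Longrightarrow> closed X"
  shows "closed (P \<inter> \<Inter>\<X>)"
proof -
  have "perp (perp (P \<inter> \<Inter>\<X>)) \<subseteq> X" if "X \<in> \<X>" for X
    using that assms by (intro closed_hull_least) auto
  then show ?thesis
    unfolding closed_def using perp_subset perp_perp_extensive[of "P \<inter> \<Inter>\<X>"] by blast
qed

text \<open>\<open>cneg a\<close> is the largest element orthogonal to \<open>a\<close>, and
  whatever is orthogonal to \<open>a\<close> is orthogonal to everything below
  \<open>a\<close>.\<close>

lemma perp_principal:
  assumes a: "a \<in> P"
  shows "perp {b \<in> P. b \<preceq> a} = {b \<in> P. b \<preceq> cneg a}"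
proof
  show "perp {b \<in> P. b \<preceq> a} \<subseteq> {b \<in> P. b \<preceq> cneg a}"
    using a by (auto simp: perp_def leq_cneg)
  have "c \<odot> b \<preceq> falsum" if "c \<in> P" "c \<odot> a \<preceq> falsum" "b \<in> P" "b \<preceq> a" for b c
    using that a conj_mono[of c b c a] leq_trans by auto
  then show "{b \<in> P. b \<preceq> cneg a} \<subseteq> perp {b \<in> P. b \<preceq> a}"
    using a by (auto simp: perp_def leq_cneg)
qed

lemma cneg_cneg_leq_iff: "a \<in> P \<Longrightarrow> b \<in> P \<Longrightarrow> b \<preceq> cneg (cneg a) \<longleftrightarrow> b \<preceq> a"
proof -
  assume *: "a \<in> P" "b \<in> P"
  have "a \<preceq> cneg (cneg a)"
    using * leq_cneg[of a "cneg a"] leq_cneg[of "cneg a" a] orth_commute by auto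
  then show ?thesis using * cneg_cneg leq_trans by blast
qed

text \<open>Applying \<open>perp_principal\<close> twice gives the down-set of the double complement
  of \<open>a\<close>; this is where the preorder has to be Boolean and not merely a Heyting
  one.\<close>

lemma closed_principal: "a \<in> P \<Longrightarrow> closed {b \<in> P. b \<preceq> a}"
  unfolding closed_def
  by (auto simp: perp_principal cneg_cneg_leq_iff)

section \<open>The completion as a complete lattice\<close>

lemma carrier_completionE:
  assumes "x \<in> carrier completion"
  obtains X where "closed X" "x = emb X"
  using assms by (auto simp: completion_def)

lemma emb_in_carrier [simp]: "emb X \<in> carrier completion \<longleftrightarrow> closed X"
  using inj_emb by (auto simp: completion_def dest: injD)

lemma le_completion [simp]: "emb X \<sqsubseteq>\<^bsub>completion\<^esub> emb Y \<longleftrightarrow> X \<subseteq> Y"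
  by (simp add: completion_def inj_emb)

lemma principal_in_carrier [simp]: "a \<in> P \<Longrightarrow> principal a \<in> carrier completion"
  by (simp add: principal_def closed_principal)

lemma subset_carrier_completion:
  assumes "A \<subseteq> carrier completion"
  obtains \<X> where "A = emb ` \<X>" "\<And>X. X \<in> \<X> \<Longrightarrow> closed X"
proof
  show "A = emb ` {X. closed X \<and> emb X \<in> A}"
    using assms by (auto simp: completion_def)
qed auto

lemma partial_order_completion: "partial_order completion"
  using injD[OF inj_emb] by unfold_locales (auto simp: completion_def inj_emb)

interpretation completion: partial_order completion
  by (fact partial_order_completion)

lemma emb_in_Upper:
  "(\<And>X. X \<in> \<X> \<Longrightarrow> closed X) \<Longrightarrow>
    emb Y \<in> Upper completion (emb ` \<X>) \<longleftrightarrow> closed Y \<and> \<Union>\<X> \<subseteq> Y"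
  by (simp add: Upper_def imp_conjL Sup_le_iff flip: Ball_def) auto

lemma emb_in_Lower:
  "(\<And>X. X \<in> \<X> \<Longrightarrow> closed X) \<Longrightarrow>
    emb Y \<in> Lower completion (emb ` \<X>) \<longleftrightarrow> closed Y \<and> Y \<subseteq> \<Inter>\<X>"
  by (simp add: Lower_def imp_conjL le_Inf_iff flip: Ball_def) auto

lemma is_lub_emb:
  assumes "\<And>X. X \<in> \<X> \<Longrightarrow> closed X"
  shows "is_lub completion (emb (perp (perp (\<Union>\<X>)))) (emb ` \<X>)"
proof (unfold least_def, intro conjI ballI)
  have sub: "\<Union>\<X> \<subseteq> P" using assms closed_subset by blast
  then show "emb (perp (perp (\<Union>\<X>))) \<in> Upper completion (emb ` \<X>)"
    using assms by (simp add: emb_in_Upper closed_perp perp_subset perp_perp_extensive)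
  fix y assume y: "y \<in> Upper completion (emb ` \<X>)"
  then obtain Y where "closed Y" "y = emb Y"
    by (meson Upper_closed carrier_completionE subsetD)
  then show "emb (perp (perp (\<Union>\<X>))) \<sqsubseteq>\<^bsub>completion\<^esub> y"
    using y assms by (simp add: emb_in_Upper closed_hull_least)
qed simp

lemma is_glb_emb:
  assumes "\<And>X. X \<in> \<X> \<Longrightarrow> closed X"
  shows "is_glb completion (emb (P \<inter> \<Inter>\<X>)) (emb ` \<X>)"
proof (unfold greatest_def, intro conjI ballI)
  show "emb (P \<inter> \<Inter>\<X>) \<in> Lower completion (emb ` \<X>)"
    using assms by (simp add: emb_in_Lower closed_Inter)
  fix y assume y: "y \<in> Lower completion (emb ` \<X>)"
  then obtain Y where "closed Y" "y = emb Y"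
    by (meson Lower_closed carrier_completionE subsetD)
  then show "y \<sqsubseteq>\<^bsub>completion\<^esub> emb (P \<inter> \<Inter>\<X>)"
    using y assms closed_subset by (simp add: emb_in_Lower)
qed simp

lemma sup_completionI: "is_lub completion x A \<Longrightarrow> \<Squnion>\<^bsub>completion\<^esub> A = x"
  unfolding sup_def by (blast intro: completion.least_unique some_equality)

lemma inf_completionI: "is_glb completion x A \<Longrightarrow> \<Sqinter>\<^bsub>completion\<^esub> A = x"
  unfolding inf_def by (blast intro: completion.greatest_unique some_equality)

lemma complete_lattice_completion: "complete_lattice completion"
proof (rule completion.complete_latticeI)
  fix A assume "A \<subseteq> carrier completion"
  then obtain \<X> where "A = emb ` \<X>" "\<And>X. X \<in> \<X> \<Longrightarrow> closed X"
    by (rule subset_carrier_completion) auto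
  then show "\<exists>s. is_lub completion s A" "\<exists>i. is_glb completion i A"
    using is_lub_emb is_glb_emb by blast+
qed

lemma join_emb:
  "closed X \<Longrightarrow> closed Y \<Longrightarrow> emb X \<squnion>\<^bsub>completion\<^esub> emb Y = emb (perp (perp (X \<union> Y)))"
  using sup_completionI[OF is_lub_emb[of "{X, Y}"]] by (auto simp: join_def)

lemma meet_emb: "closed X \<Longrightarrow> closed Y \<Longrightarrow> emb X \<sqinter>\<^bsub>completion\<^esub> emb Y = emb (X \<inter> Y)"
proof -
  assume X: "closed X" and "closed Y"
  then have "emb X \<sqinter>\<^bsub>completion\<^esub> emb Y = emb (P \<inter> (X \<inter> Y))"
    using inf_completionI[OF is_glb_emb[of "{X, Y}"]] by (auto simp: meet_def)
  also have "P \<inter> (X \<inter> Y) = X \<inter> Y" using closed_subset[OF X] by blast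
  finally show ?thesis .
qed

lemma closed_Int: "closed X \<Longrightarrow> closed Y \<Longrightarrow> closed (X \<inter> Y)"
  using closed_Inter[of "{X, Y}"] closed_subset[of X] by (auto simp: inf_absorb2 le_infI1)

lemma closed_carrier: "closed P"
  using closed_Inter[of "{}"] by simp

lemma closed_falsum: "closed {a \<in> P. a \<preceq> falsum}"
  by (simp add: closed_principal)

lemma top_completion: "\<top>\<^bsub>completion\<^esub> = emb P"
proof -
  have "greatest completion (emb P) (carrier completion)"
    using closed_subset by (auto elim!: carrier_completionE simp: greatest_def closed_carrier)
  then show ?thesis
    unfolding top_def by (blast intro: completion.greatest_unique some_equality)
qed

lemma bottom_completion: "\<bottom>\<^bsub>completion\<^esub> = emb {a \<in> P. a \<preceq> falsum}"
proof -
  have "{a \<in> P. a \<preceq> falsum} \<subseteq> X" if "closed X" for X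
    using that closed_down falsum_in_closed by blast
  then have "least completion (emb {a \<in> P. a \<preceq> falsum}) (carrier completion)"
    by (simp add: least_def closed_falsum) (auto elim!: carrier_completionE)
  then show ?thesis
    unfolding bottom_def by (blast intro: completion.least_unique some_equality)
qed

text \<open>For the inclusion from left to right, let a belong to the left side and b be orthogonal
  to both traces. The meet of a, b and any y of Y lies in the trace of X on Y, so it is orthogonal
  to b; being below b, it is below \<open>falsum\<close>. The same holds for Z. So the meet of a and
  b is orthogonal to Y and Z, hence to a, and being below a it is below \<open>falsum\<close> as
  well.\<close>

lemma distrib_closed:
  assumes X: "closed X" and Y: "closed Y" and Z: "closed Z"
  shows "X \<inter> perp (perp (Y \<union> Z)) = perp (perp ((X \<inter> Y) \<union> (X \<inter> Z)))" (is "?L = ?R")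
proof
  show "?R \<subseteq> ?L"
  proof (rule closed_hull_least)
    have "Y \<union> Z \<subseteq> perp (perp (Y \<union> Z))"
      using Y Z closed_subset by (intro perp_perp_extensive) auto
    then show "(X \<inter> Y) \<union> (X \<inter> Z) \<subseteq> ?L" by auto
    show "closed ?L" using X by (simp add: closed_Int closed_perp perp_subset)
  qed
  show "?L \<subseteq> ?R"
  proof
    fix a assume a: "a \<in> ?L"
    then have aP: "a \<in> P" using perp_subset by blast
    have "a \<odot> b \<preceq> falsum" if b: "b \<in> perp ((X \<inter> Y) \<union> (X \<inter> Z))" for b
    proof -
      have bP: "b \<in> P" using b perp_subset by blast
      \<comment> \<open>W stands for Y or for Z.\<close>
      have orth: "(a \<odot> b) \<odot> y \<preceq> falsum" if W: "closed W" "X \<inter> W \<subseteq> (X \<inter> Y) \<union> (X \<inter> Z)" "y \<in> W" for W y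
      proof -
        have yP: "y \<in> P" using W closed_subset by blast
        let ?d = "(a \<odot> b) \<odot> y"
        have dP: "?d \<in> P" using aP bP yP by simp
        have d: "?d \<preceq> a \<odot> b" "?d \<preceq> y" using aP bP yP by (simp_all add: conj_leq1 conj_leq2)
        have da: "?d \<preceq> a" and db: "?d \<preceq> b"
          using leq_trans[OF d(1) conj_leq1] leq_trans[OF d(1) conj_leq2] aP bP by auto
        have "?d \<in> X \<inter> W"
          using a closed_down[OF X _ dP da] closed_down[OF W(1,3) dP d(2)] by auto
        then have "b \<odot> ?d \<preceq> falsum" using b W(2) by (auto simp: perp_def)
        moreover have "?d \<preceq> b \<odot> ?d" using db dP by (simp add: leq_conj)
        ultimately show ?thesis by (rule leq_trans[rotated])
      qed
      have "a \<odot> b \<in> perp (Y \<union> Z)"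
        using orth[OF Y] orth[OF Z] aP bP by (auto simp: perp_def)
      then have "a \<odot> (a \<odot> b) \<preceq> falsum" using a by (auto simp: perp_def)
      moreover have "a \<odot> b \<preceq> a \<odot> (a \<odot> b)" using aP bP by (simp add: leq_conj conj_leq1)
      ultimately show ?thesis by (rule leq_trans[rotated])
    qed
    then show "a \<in> ?R" using aP by (auto simp: perp_def)
  qed
qed

lemma closed_falsum_least: "closed X \<Longrightarrow> {a \<in> P. a \<preceq> falsum} \<subseteq> X"
  using closed_down falsum_in_closed by blast

text \<open>A common element is orthogonal to itself.\<close>

lemma Int_perp: "closed X \<Longrightarrow> X \<inter> perp X = {a \<in> P. a \<preceq> falsum}"
proof
  show "X \<inter> perp X \<subseteq> {a \<in> P. a \<preceq> falsum}"
    unfolding perp_def by (blast intro: orth_self)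
  assume "closed X"
  then show "{a \<in> P. a \<preceq> falsum} \<subseteq> X \<inter> perp X"
    using closed_falsum_least[of X] closed_falsum_least[OF closed_perp[OF closed_subset]] by blast
qed

text \<open>An element orthogonal to both X and \<open>perp X\<close> lies in \<open>perp X\<close>
  and in its orthogonal, so it is orthogonal to itself and below \<open>falsum\<close>. Everything
  in P is orthogonal to such elements.\<close>

lemma Un_perp: "closed X \<Longrightarrow> perp (perp (X \<union> perp X)) = P"
proof
  assume X: "closed X"
  have "b \<preceq> falsum" if "b \<in> perp (X \<union> perp X)" for b
  proof -
    have "b \<in> perp X" "b \<in> perp (perp X)" using that by (auto simp: perp_def)
    then have "b \<in> P" "b \<odot> b \<preceq> falsum" unfolding perp_def by blast+
    then show ?thesis by (rule orth_self)
  qed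
  moreover have "a \<odot> b \<preceq> falsum" if "b \<preceq> falsum" "a \<in> P" "b \<in> P" for a b
    using that leq_trans[OF conj_leq2[of a b]] by simp
  ultimately show "P \<subseteq> perp (perp (X \<union> perp X))"
    unfolding perp_def[of "perp (X \<union> perp X)"] using perp_subset[of "X \<union> perp X"] by blast
qed (rule perp_subset)

lemma is_compl_emb: "closed X \<Longrightarrow> is_compl completion (emb X) (emb (perp X))"
  by (simp add: is_compl_def meet_emb join_emb closed_perp closed_subset top_completion
      bottom_completion Int_perp Un_perp)

lemma complete_boolean_completion: "complete_boolean completion"
  unfolding complete_boolean_def
proof (intro conjI ballI)
  fix x y z
  assume "x \<in> carrier completion" "y \<in> carrier completion" "z \<in> carrier completion"
  then show "x \<sqinter>\<^bsub>completion\<^esub> (y \<squnion>\<^bsub>completion\<^esub> z) =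
      (x \<sqinter>\<^bsub>completion\<^esub> y) \<squnion>\<^bsub>completion\<^esub> (x \<sqinter>\<^bsub>completion\<^esub> z)"
    by (auto elim!: carrier_completionE simp: join_emb meet_emb closed_Int closed_perp perp_subset
        distrib_closed)
next
  fix x assume "x \<in> carrier completion"
  then show "\<exists>y. is_compl completion x y"
    using is_compl_emb by (auto elim: carrier_completionE)
qed (rule complete_lattice_completion)

text \<open>\<open>compl\<close> is a definite description, so uniqueness is required: a trivial
  meet with X puts Y inside \<open>perp X\<close>, and a full join with X gives the converse by
  distributivity.\<close>

lemma compl_emb:
  assumes X: "closed X"
  shows "compl completion (emb X) = emb (perp X)"
  unfolding compl_def
proof (rule the_equality)
  show "is_compl completion (emb X) (emb (perp X))" using X by (rule is_compl_emb)
  fix y assume y: "is_compl completion (emb X) y"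
  then obtain Y where Y: "closed Y" "y = emb Y" by (auto simp: is_compl_def elim: carrier_completionE)
  have XY: "X \<inter> Y = {a \<in> P. a \<preceq> falsum}" and un: "perp (perp (X \<union> Y)) = P"
    using y X Y injD[OF inj_emb]
    by (auto simp: is_compl_def meet_emb join_emb top_completion bottom_completion)
  have "Y \<subseteq> perp X"
  proof
    fix b assume b: "b \<in> Y"
    have bP: "b \<in> P" using b Y closed_subset by blast
    have "b \<odot> a \<preceq> falsum" if a: "a \<in> X" for a
    proof -
      have aP: "a \<in> P" using a X closed_subset by blast
      have "b \<odot> a \<in> X \<inter> Y"
        using closed_down[OF X a] closed_down[OF Y(1) b] aP bP by (simp add: conj_leq1 conj_leq2)
      then show ?thesis using XY by auto
    qed
    then show "b \<in> perp X" using bP by (auto simp: perp_def)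
  qed
  moreover have "perp X \<subseteq> Y"
  proof -
    have "perp X = perp X \<inter> perp (perp (X \<union> Y))" using un perp_subset by blast
    \<comment> \<open>Distributing over X and Y leaves a bottom part and a part inside Y.\<close>
    also have "\<dots> = perp (perp ((perp X \<inter> X) \<union> (perp X \<inter> Y)))"
      using X Y by (simp add: distrib_closed closed_perp closed_subset)
    also have "\<dots> \<subseteq> Y"
      using Int_perp[OF X] closed_down[OF Y(1)] falsum_in_closed[OF Y(1)] Y(1)
      by (intro closed_hull_least) auto
    finally show ?thesis .
  qed
  ultimately show "y = emb (perp X)" using Y by auto
qed

section \<open>Classes of single elements\<close>

lemma compl_principal: "a \<in> P \<Longrightarrow> compl completion (principal a) = principal (cneg a)"
  by (simp add: principal_def compl_emb closed_principal perp_principal)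

lemma principal_eq_iff: "a \<in> P \<Longrightarrow> b \<in> P \<Longrightarrow> principal a = principal b \<longleftrightarrow> a \<preceq> b \<and> b \<preceq> a"
proof -
  assume P: "a \<in> P" "b \<in> P"
  have "principal a = principal b \<longleftrightarrow> {c \<in> P. c \<preceq> a} = {c \<in> P. c \<preceq> b}"
    by (simp add: principal_def inj_eq[OF inj_emb])
  also have "\<dots> \<longleftrightarrow> a \<preceq> b \<and> b \<preceq> a"
    using P by (auto simp: set_eq_iff intro: leq_trans)
  finally show ?thesis .
qed

lemma principal_eq_top_iff: "a \<in> P \<Longrightarrow> principal a = \<top>\<^bsub>completion\<^esub> \<longleftrightarrow> (\<forall>b\<in>P. b \<preceq> a)"
  by (auto simp: principal_def top_completion inj_eq[OF inj_emb])

text \<open>The starred hypothesis makes c an infimum of S in the preorder. The completion keeps it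
  because the down-set of c is the intersection of the down-sets of the members of S.\<close>

lemma inf_principal:
  assumes "c \<in> P" "S \<subseteq> P" and *: "\<And>b. b \<in> P \<Longrightarrow> b \<preceq> c \<longleftrightarrow> (\<forall>s\<in>S. b \<preceq> s)"
  shows "\<Sqinter>\<^bsub>completion\<^esub> (principal ` S) = principal c"
proof -
  let ?\<X> = "(\<lambda>s. {b \<in> P. b \<preceq> s}) ` S"
  have "\<Sqinter>\<^bsub>completion\<^esub> (emb ` ?\<X>) = emb (P \<inter> \<Inter>?\<X>)"
    using assms closed_principal by (intro inf_completionI is_glb_emb) auto
  moreover have "P \<inter> \<Inter>?\<X> = {b \<in> P. b \<preceq> c}" using * by auto
  ultimately show ?thesis by (simp add: principal_def image_image)
qed

text \<open>The join is a double orthogonal, so it is enough to compare orthogonals. There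
  \<open>cneg\<close> reverses the order: b is orthogonal to all of S iff \<open>cneg b\<close>
  bounds S from above, that is, iff \<open>cneg b\<close> is above c.\<close>

lemma sup_principal:
  assumes "c \<in> P" "S \<subseteq> P" and *: "\<And>b. b \<in> P \<Longrightarrow> c \<preceq> b \<longleftrightarrow> (\<forall>s\<in>S. s \<preceq> b)"
  shows "\<Squnion>\<^bsub>completion\<^esub> (principal ` S) = principal c"
proof -
  let ?\<X> = "(\<lambda>s. {b \<in> P. b \<preceq> s}) ` S"
  have "\<Squnion>\<^bsub>completion\<^esub> (emb ` ?\<X>) = emb (perp (perp (\<Union>?\<X>)))"
    using assms closed_principal by (intro sup_completionI is_lub_emb) auto
  moreover have "perp (perp (\<Union>?\<X>)) = {b \<in> P. b \<preceq> c}"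
  proof -
    have "perp (\<Union>?\<X>) = perp {b \<in> P. b \<preceq> c}"
    proof (rule Set.set_eqI)
      fix b
      show "b \<in> perp (\<Union>?\<X>) \<longleftrightarrow> b \<in> perp {b \<in> P. b \<preceq> c}"
      proof (cases "b \<in> P")
        case True
        have "b \<in> perp (\<Union>?\<X>) \<longleftrightarrow> (\<forall>s\<in>S. b \<in> perp {b \<in> P. b \<preceq> s})"
          using True by (auto simp: perp_def)
        also have "\<dots> \<longleftrightarrow> (\<forall>s\<in>S. b \<preceq> cneg s)"
          using True assms(2) by (intro ball_cong) (auto simp: perp_principal subset_iff)
        also have "\<dots> \<longleftrightarrow> (\<forall>s\<in>S. s \<preceq> cneg b)"
          using True assms(2) by (intro ball_cong leq_cneg_commute) auto
        also have "\<dots> \<longleftrightarrow> c \<preceq> cneg b" using * True by simp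
        also have "\<dots> \<longleftrightarrow> b \<preceq> cneg c" using True assms(1) by (intro leq_cneg_commute) auto
        also have "\<dots> \<longleftrightarrow> b \<in> perp {b \<in> P. b \<preceq> c}" using True assms(1) by (simp add: perp_principal)
        finally show ?thesis .
      qed (use perp_subset in blast)
    qed
    then show ?thesis using assms(1) closed_principal by (simp add: closed_def)
  qed
  ultimately show ?thesis by (simp add: principal_def image_image)
qed

lemma meet_principal:
  assumes "a \<in> P" "b \<in> P"
  shows "principal a \<sqinter>\<^bsub>completion\<^esub> principal b = principal (a \<odot> b)"
proof -
  have "\<Sqinter>\<^bsub>completion\<^esub> (principal ` {a, b}) = principal (a \<odot> b)"
  proof (rule inf_principal)
    fix d assume "d \<in> P"
    show "d \<preceq> a \<odot> b \<longleftrightarrow> (\<forall>s\<in>{a, b}. d \<preceq> s)"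
      using leq_trans[OF _ conj_leq1[OF assms]] leq_trans[OF _ conj_leq2[OF assms]] leq_conj
      by (metis insertE insertI1 insertI2 singletonD)
  qed (use assms in auto)
  then show ?thesis by (simp add: meet_def)
qed

lemma join_principal:
  assumes "a \<in> P" "b \<in> P" "c \<in> P" "\<And>d. d \<in> P \<Longrightarrow> c \<preceq> d \<longleftrightarrow> a \<preceq> d \<and> b \<preceq> d"
  shows "principal a \<squnion>\<^bsub>completion\<^esub> principal b = principal c"
  using sup_principal[of c "{a, b}"] assms by (simp add: join_def)

end

section \<open>The Lindenbaum preorder\<close>

text \<open>The language has no constant for falsity, so some formula \<delta> has to be at hand
  from which \<open>falsum\<close> is built. The theorem takes the formula to be derived.\<close>

locale lfi_theory =
  fixes \<Theta> :: "('c, 'f, 'p) signature"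
    and \<Gamma> :: "('c, 'f, 'p) fm set"
    and \<delta> :: "('c, 'f, 'p) fm"
  assumes premises_wf: "\<Gamma> \<subseteq> For \<Theta>"
    and delta_wf: "wf_fm \<Theta> \<delta>"
begin

abbreviation provable :: "('c, 'f, 'p) fm \<Rightarrow> bool" (\<open>\<turnstile> _\<close> [40] 40) where
  "\<turnstile> \<alpha> \<equiv> derives \<Theta> \<Gamma> \<alpha>"

abbreviation wf :: "('c, 'f, 'p) fm \<Rightarrow> bool" where
  "wf \<equiv> wf_fm \<Theta>"

definition leq :: "('c, 'f, 'p) fm \<Rightarrow> ('c, 'f, 'p) fm \<Rightarrow> bool" (infix \<open>\<preceq>\<close> 50) where
  "\<alpha> \<preceq> \<beta> \<longleftrightarrow> \<turnstile> Imp \<alpha> \<beta>"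

definition falsum :: "('c, 'f, 'p) fm" where
  "falsum = And \<delta> (And (Neg \<delta>) (Circ \<delta>))"

section \<open>Propositional reasoning as inequalities\<close>

lemma derives_wf: "\<turnstile> \<alpha> \<Longrightarrow> wf \<alpha>"
  by (induction rule: derives.induct) (use premises_wf in \<open>auto simp: For_def\<close>)

lemma derives_ax: "ax \<alpha> \<Longrightarrow> wf \<alpha> \<Longrightarrow> \<turnstile> \<alpha>"
  by (simp add: Axiom For_def)

lemma leq_wf: "\<alpha> \<preceq> \<beta> \<Longrightarrow> wf \<alpha> \<and> wf \<beta>"
  unfolding leq_def using derives_wf by fastforce

lemma leq_mp: "\<turnstile> \<alpha> \<Longrightarrow> \<alpha> \<preceq> \<beta> \<Longrightarrow> \<turnstile> \<beta>"
  unfolding leq_def by (rule MP)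

lemma leq_ax: "ax (Imp \<alpha> \<beta>) \<Longrightarrow> wf \<alpha> \<Longrightarrow> wf \<beta> \<Longrightarrow> \<alpha> \<preceq> \<beta>"
  by (simp add: leq_def derives_ax)

lemma provable_leq: "\<turnstile> \<beta> \<Longrightarrow> wf \<alpha> \<Longrightarrow> \<alpha> \<preceq> \<beta>"
  unfolding leq_def by (frule derives_wf, erule MP) (auto intro!: derives_ax A1)

text \<open>Modus ponens under a hypothesis, by \<open>A2\<close>. It takes the place of a deduction
  theorem, which the quantifier rules would restrict.\<close>

lemma leq_S:
  assumes "\<alpha> \<preceq> Imp \<beta> \<gamma>" "\<alpha> \<preceq> \<beta>"
  shows "\<alpha> \<preceq> \<gamma>"
proof -
  have "wf \<alpha>" "wf \<beta>" "wf \<gamma>" using assms leq_wf by fastforce+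
  then have "\<turnstile> Imp (Imp \<alpha> (Imp \<beta> \<gamma>)) (Imp (Imp \<alpha> \<beta>) (Imp \<alpha> \<gamma>))"
    by (intro derives_ax A2) auto
  from MP[OF assms(2)[unfolded leq_def] MP[OF assms(1)[unfolded leq_def] this]]
  show ?thesis by (simp add: leq_def)
qed

lemma leq_trans [trans]: "\<alpha> \<preceq> \<beta> \<Longrightarrow> \<beta> \<preceq> \<gamma> \<Longrightarrow> \<alpha> \<preceq> \<gamma>"
proof -
  assume *: "\<alpha> \<preceq> \<beta>" "\<beta> \<preceq> \<gamma>"
  then have "\<alpha> \<preceq> Imp \<beta> \<gamma>"
    unfolding leq_def[of \<beta>] by (blast dest: leq_wf intro: provable_leq)
  then show ?thesis using *(1) by (rule leq_S)
qed

lemma leq_refl: "wf \<alpha> \<Longrightarrow> \<alpha> \<preceq> \<alpha>"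
  by (rule leq_S[of \<alpha> "Imp \<alpha> \<alpha>"]; rule leq_ax) (auto intro: A1)

lemma leq_And: "\<gamma> \<preceq> \<alpha> \<Longrightarrow> \<gamma> \<preceq> \<beta> \<Longrightarrow> \<gamma> \<preceq> And \<alpha> \<beta>"
proof -
  assume *: "\<gamma> \<preceq> \<alpha>" "\<gamma> \<preceq> \<beta>"
  then have "\<alpha> \<preceq> Imp \<beta> (And \<alpha> \<beta>)" using leq_wf by (intro leq_ax A3) auto
  then show ?thesis by (rule leq_S[OF leq_trans[OF *(1)] *(2)])
qed

lemma And_leq1: "wf \<alpha> \<Longrightarrow> wf \<beta> \<Longrightarrow> And \<alpha> \<beta> \<preceq> \<alpha>"
  by (simp add: leq_ax A4)

lemma And_leq2: "wf \<alpha> \<Longrightarrow> wf \<beta> \<Longrightarrow> And \<alpha> \<beta> \<preceq> \<beta>"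
  by (simp add: leq_ax A5)

lemma leq_And_iff: "\<gamma> \<preceq> And \<alpha> \<beta> \<longleftrightarrow> \<gamma> \<preceq> \<alpha> \<and> \<gamma> \<preceq> \<beta>"
proof
  assume *: "\<gamma> \<preceq> And \<alpha> \<beta>"
  then have "wf \<alpha>" "wf \<beta>" using leq_wf by fastforce+
  then show "\<gamma> \<preceq> \<alpha> \<and> \<gamma> \<preceq> \<beta>"
    using leq_trans[OF * And_leq1] leq_trans[OF * And_leq2] by simp
qed (simp add: leq_And)

lemma leq_Or1: "wf \<alpha> \<Longrightarrow> wf \<beta> \<Longrightarrow> \<alpha> \<preceq> Or \<alpha> \<beta>"
  by (simp add: leq_ax A6)

lemma leq_Or2: "wf \<alpha> \<Longrightarrow> wf \<beta> \<Longrightarrow> \<beta> \<preceq> Or \<alpha> \<beta>"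
  by (simp add: leq_ax A7)

lemma Or_leq: "\<alpha> \<preceq> \<gamma> \<Longrightarrow> \<beta> \<preceq> \<gamma> \<Longrightarrow> Or \<alpha> \<beta> \<preceq> \<gamma>"
proof -
  assume *: "\<alpha> \<preceq> \<gamma>" "\<beta> \<preceq> \<gamma>"
  then have "\<turnstile> Imp (Imp \<alpha> \<gamma>) (Imp (Imp \<beta> \<gamma>) (Imp (Or \<alpha> \<beta>) \<gamma>))"
    using leq_wf by (intro derives_ax A8) auto
  from MP[OF *(2)[unfolded leq_def] MP[OF *(1)[unfolded leq_def] this]]
  show ?thesis by (simp add: leq_def)
qed

lemma Or_leq_iff: "Or \<alpha> \<beta> \<preceq> \<gamma> \<longleftrightarrow> \<alpha> \<preceq> \<gamma> \<and> \<beta> \<preceq> \<gamma>"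
proof
  assume *: "Or \<alpha> \<beta> \<preceq> \<gamma>"
  then have "wf \<alpha>" "wf \<beta>" using leq_wf by fastforce+
  then show "\<alpha> \<preceq> \<gamma> \<and> \<beta> \<preceq> \<gamma>"
    using leq_trans[OF leq_Or1 *] leq_trans[OF leq_Or2 *] by simp
qed (simp add: Or_leq)

lemma leq_Imp_iff:
  assumes "wf \<alpha>" "wf \<beta>"
  shows "\<alpha> \<preceq> Imp \<beta> \<gamma> \<longleftrightarrow> And \<alpha> \<beta> \<preceq> \<gamma>"
proof
  assume "\<alpha> \<preceq> Imp \<beta> \<gamma>"
  then show "And \<alpha> \<beta> \<preceq> \<gamma>"
    by (rule leq_S[OF leq_trans[OF And_leq1[OF assms]] And_leq2[OF assms]])
next
  assume "And \<alpha> \<beta> \<preceq> \<gamma>"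
  then have "\<turnstile> Imp (And \<alpha> \<beta>) \<gamma>" "wf \<gamma>" using leq_wf by (auto simp: leq_def)
  then have K: "\<beta> \<preceq> Imp (And \<alpha> \<beta>) \<gamma>" using assms by (intro provable_leq)
  have "\<turnstile> Imp (Imp \<beta> (Imp (And \<alpha> \<beta>) \<gamma>)) (Imp (Imp \<beta> (And \<alpha> \<beta>)) (Imp \<beta> \<gamma>))"
    using assms \<open>wf \<gamma>\<close> by (intro derives_ax A2) auto
  from MP[OF K[unfolded leq_def] this] have "Imp \<beta> (And \<alpha> \<beta>) \<preceq> Imp \<beta> \<gamma>" by (simp add: leq_def)
  moreover have "\<alpha> \<preceq> Imp \<beta> (And \<alpha> \<beta>)" using assms by (intro leq_ax A3) auto
  ultimately show "\<alpha> \<preceq> Imp \<beta> \<gamma>" by (rule leq_trans[rotated])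
qed

lemma falsum_wf: "wf falsum"
  by (simp add: falsum_def delta_wf)

lemma explosion: "And \<alpha> (And (Neg \<alpha>) (Circ \<alpha>)) \<preceq> \<beta>" if "wf \<alpha>" "wf \<beta>" for \<alpha> \<beta>
proof -
  let ?c = "And \<alpha> (And (Neg \<alpha>) (Circ \<alpha>))"
  have c: "?c \<preceq> \<alpha>" "?c \<preceq> Neg \<alpha>" "?c \<preceq> Circ \<alpha>"
    using that leq_refl[of ?c] by (simp_all add: leq_And_iff)
  have "Circ \<alpha> \<preceq> Imp \<alpha> (Imp (Neg \<alpha>) \<beta>)" using that by (intro leq_ax A11) auto
  from leq_S[OF leq_S[OF leq_trans[OF c(3) this] c(1)] c(2)] show ?thesis .
qed

lemma falsum_leq: "wf \<alpha> \<Longrightarrow> falsum \<preceq> \<alpha>"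
  by (simp add: falsum_def explosion delta_wf)

lemma excluded_middle: "wf \<alpha> \<Longrightarrow> wf \<beta> \<Longrightarrow> wf \<gamma> \<Longrightarrow> \<gamma> \<preceq> Or \<alpha> (Imp \<alpha> \<beta>)"
  by (simp add: provable_leq derives_ax A9)

lemma And_commute: "wf \<alpha> \<Longrightarrow> wf \<beta> \<Longrightarrow> And \<alpha> \<beta> \<preceq> And \<beta> \<alpha>"
  by (simp add: leq_And_iff And_leq1 And_leq2)

text \<open>Distributivity in disguise: \<open>Imp\<close> is residual to \<open>And\<close>, so
  both cases become bounds by \<open>Imp \<gamma> \<epsilon>\<close>, and \<open>A8\<close> joins
  them.\<close>

lemma leq_cases:
  assumes "\<gamma> \<preceq> Or \<alpha> \<beta>" "And \<gamma> \<alpha> \<preceq> \<epsilon>" "And \<gamma> \<beta> \<preceq> \<epsilon>"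
  shows "\<gamma> \<preceq> \<epsilon>"
proof -
  have wf: "wf \<gamma>" "wf \<alpha>" "wf \<beta>" using assms leq_wf by fastforce+
  have "\<alpha> \<preceq> Imp \<gamma> \<epsilon>" "\<beta> \<preceq> Imp \<gamma> \<epsilon>"
    using leq_trans[OF And_commute assms(2)] leq_trans[OF And_commute assms(3)] wf
    by (simp_all add: leq_Imp_iff)
  then have "Or \<alpha> \<beta> \<preceq> Imp \<gamma> \<epsilon>" by (rule Or_leq)
  from leq_S[OF leq_trans[OF assms(1) this] leq_refl[OF wf(1)]] show ?thesis .
qed

lemma modus_ponens_leq: "wf \<alpha> \<Longrightarrow> wf \<beta> \<Longrightarrow> And (Imp \<alpha> \<beta>) \<alpha> \<preceq> \<beta>"
  using leq_Imp_iff[of "Imp \<alpha> \<beta>" \<alpha> \<beta>] leq_refl by simp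

text \<open>Case distinction by \<open>A9\<close> with \<open>falsum\<close> as consequent: either
  \<alpha> holds, or \<alpha> implies \<open>falsum\<close> and the hypothesis explodes.\<close>

lemma double_negation:
  assumes "wf \<alpha>"
  shows "Imp (Imp \<alpha> falsum) falsum \<preceq> \<alpha>"
proof (rule leq_cases)
  let ?n = "Imp \<alpha> falsum"
  show "Imp ?n falsum \<preceq> Or \<alpha> ?n" using assms falsum_wf by (simp add: excluded_middle)
  show "And (Imp ?n falsum) \<alpha> \<preceq> \<alpha>" using assms falsum_wf by (simp add: And_leq2)
  have "And (Imp ?n falsum) ?n \<preceq> falsum" using assms falsum_wf by (intro modus_ponens_leq) auto
  then show "And (Imp ?n falsum) ?n \<preceq> \<alpha>" by (rule leq_trans[OF _ falsum_leq[OF assms]])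
qed

text \<open>The Boolean complement is implication of \<open>falsum\<close>, not the paraconsistent
  \<open>Neg\<close>, which is compatible with its argument. \<open>Inr\<close> places the cuts in
  the kind of type on which \<open>entails\<close> is used.\<close>

sublocale lindenbaum: boolean_preorder "For \<Theta>" leq And falsum "\<lambda>\<alpha>. Imp \<alpha> falsum"
  "Inr :: ('c, 'f, 'p) fm set \<Rightarrow> 'b + ('c, 'f, 'p) fm set"
  by unfold_locales
    (erule (1) leq_trans | simp add: For_def falsum_wf leq_refl And_leq1 And_leq2 leq_And
      falsum_leq leq_Imp_iff double_negation)+

end

section \<open>Substitution without capture\<close>

lemma subst_tm_Var [simp]: "subst_tm Var t = t"
  by (induction t) (auto intro: map_idI)

lemma subst_tm_cong: "(\<And>y. y \<in> fv_tm t \<Longrightarrow> \<sigma> y = \<tau> y) \<Longrightarrow> subst_tm \<sigma> t = subst_tm \<tau> t"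
  by (induction t) auto

lemma subst_tm_subst_tm: "subst_tm \<tau> (subst_tm \<sigma> t) = subst_tm (\<lambda>y. subst_tm \<tau> (\<sigma> y)) t"
  by (induction t) auto

lemma subst_tm_upd_fresh: "x \<notin> fv_tm t \<Longrightarrow> subst_tm (\<sigma>(x := u)) t = subst_tm \<sigma> t"
  by (rule subst_tm_cong) auto

lemma fv_subst_tm: "fv_tm (subst_tm \<sigma> t) = (\<Union>y\<in>fv_tm t. fv_tm (\<sigma> y))"
  by (induction t) auto

lemma finite_fv_tm [simp]: "finite (fv_tm t)"
  by (induction t) auto

lemma finite_fv [simp]: "finite (fv \<phi>)"
  by (induction \<phi>) auto

lemma wf_subst_tm: "wf_tm \<Theta> t \<Longrightarrow> (\<And>y. wf_tm \<Theta> (\<sigma> y)) \<Longrightarrow> wf_tm \<Theta> (subst_tm \<sigma> t)"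
  by (induction t) (auto simp: list_all_iff)

lemma wf_subst_fm: "wf_fm \<Theta> \<phi> \<Longrightarrow> (\<And>y. wf_tm \<Theta> (\<sigma> y)) \<Longrightarrow> wf_fm \<Theta> (subst_fm \<sigma> \<phi>)"
  by (induction \<phi> arbitrary: \<sigma>) (auto simp: list_all_iff wf_subst_tm)

lemma subst_fm_Var [simp]: "subst_fm Var \<phi> = \<phi>"
  by (induction \<phi>) (auto intro: map_idI)

lemma subst1_self [simp]: "subst1 \<phi> x (Var x) = \<phi>"
  by (simp add: subst1_def)

lemma free_for_self: "free_for (Var x) x \<phi>"
  by (induction \<phi>) auto

lemma wf_subst1: "wf_fm \<Theta> \<phi> \<Longrightarrow> wf_tm \<Theta> t \<Longrightarrow> wf_fm \<Theta> (subst1 \<phi> x t)"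
  by (simp add: subst1_def wf_subst_fm)

lemma bounded_nat_set: "finite (A :: nat set) \<Longrightarrow> \<exists>n. A \<subseteq> {..<n}"
  by (auto simp: finite_nat_set_iff_bounded)

text \<open>Bound variables are renamed to \<open>n, n + 1, \<dots>\<close> from the
  outside in, so that capture is excluded as soon as the substituted terms use only variables
  below \<open>n\<close>.\<close>

primrec csubst :: "nat \<Rightarrow> (nat \<Rightarrow> ('c, 'f) tm) \<Rightarrow> ('c, 'f, 'p) fm \<Rightarrow> ('c, 'f, 'p) fm" where
  "csubst n \<sigma> (Pred P ts) = Pred P (map (subst_tm \<sigma>) ts)"
| "csubst n \<sigma> (And \<phi> \<psi>) = And (csubst n \<sigma> \<phi>) (csubst n \<sigma> \<psi>)"
| "csubst n \<sigma> (Or \<phi> \<psi>) = Or (csubst n \<sigma> \<phi>) (csubst n \<sigma> \<psi>)"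
| "csubst n \<sigma> (Imp \<phi> \<psi>) = Imp (csubst n \<sigma> \<phi>) (csubst n \<sigma> \<psi>)"
| "csubst n \<sigma> (Neg \<phi>) = Neg (csubst n \<sigma> \<phi>)"
| "csubst n \<sigma> (Circ \<phi>) = Circ (csubst n \<sigma> \<phi>)"
| "csubst n \<sigma> (All x \<phi>) = All n (csubst (Suc n) (\<sigma>(x := Var n)) \<phi>)"
| "csubst n \<sigma> (Ex x \<phi>) = Ex n (csubst (Suc n) (\<sigma>(x := Var n)) \<phi>)"

text \<open>Relative to a set of variables, in practice a finite one: the terms that a substitution
  assigns to all variables may together use unboundedly many names.\<close>

definition bounded_on :: "nat set \<Rightarrow> nat \<Rightarrow> (nat \<Rightarrow> ('c, 'f) tm) \<Rightarrow> bool" where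
  "bounded_on V n \<sigma> \<longleftrightarrow> (\<forall>y\<in>V. fv_tm (\<sigma> y) \<subseteq> {..<n})"

lemma bounded_on_exists: "finite V \<Longrightarrow> \<exists>n. bounded_on V n \<sigma>"
  using bounded_nat_set[of "\<Union>y\<in>V. fv_tm (\<sigma> y)"] by (auto simp: bounded_on_def)

lemma bounded_on_mono: "bounded_on V n \<sigma> \<Longrightarrow> n \<le> m \<Longrightarrow> bounded_on V m \<sigma>"
  by (fastforce simp: bounded_on_def)

lemma bounded_on_Un [simp]: "bounded_on (V \<union> W) n \<sigma> \<longleftrightarrow> bounded_on V n \<sigma> \<and> bounded_on W n \<sigma>"
  by (auto simp: bounded_on_def)

lemma bounded_on_upd:
  "bounded_on (V - {x}) n \<sigma> \<Longrightarrow> fv_tm t \<subseteq> {..<n} \<Longrightarrow> bounded_on V n (\<sigma>(x := t))"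
  by (auto simp: bounded_on_def)

lemma bounded_on_upd_Suc:
  "bounded_on (V - {x}) n \<sigma> \<Longrightarrow> bounded_on V (Suc n) (\<sigma>(x := Var n))"
  by (rule bounded_on_upd) (auto elim: bounded_on_mono)

lemma csubst_cong: "(\<And>y. y \<in> fv \<phi> \<Longrightarrow> \<sigma> y = \<tau> y) \<Longrightarrow> csubst n \<sigma> \<phi> = csubst n \<tau> \<phi>"
proof (induction \<phi> arbitrary: n \<sigma> \<tau>)
  case (Pred P ts)
  then show ?case by (auto intro: subst_tm_cong)
next
  case (All x \<phi>)
  have "csubst (Suc n) (\<sigma>(x := Var n)) \<phi> = csubst (Suc n) (\<tau>(x := Var n)) \<phi>"
    using All.prems by (intro All.IH) simp
  then show ?case by simp
next
  case (Ex x \<phi>)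
  have "csubst (Suc n) (\<sigma>(x := Var n)) \<phi> = csubst (Suc n) (\<tau>(x := Var n)) \<phi>"
    using Ex.prems by (intro Ex.IH) simp
  then show ?case by simp
next
  case (Neg \<phi>)
  from Neg.IH[of \<sigma> \<tau>] Neg.prems show ?case by simp
next
  case (Circ \<phi>)
  from Circ.IH[of \<sigma> \<tau>] Circ.prems show ?case by simp
next
  case (And \<phi> \<psi>)
  from And.IH(1)[of \<sigma> \<tau>] And.IH(2)[of \<sigma> \<tau>] And.prems show ?case by simp
next
  case (Or \<phi> \<psi>)
  from Or.IH(1)[of \<sigma> \<tau>] Or.IH(2)[of \<sigma> \<tau>] Or.prems show ?case by simp
next
  case (Imp \<phi> \<psi>)
  from Imp.IH(1)[of \<sigma> \<tau>] Imp.IH(2)[of \<sigma> \<tau>] Imp.prems show ?case by simp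
qed

lemma wf_csubst: "wf_fm \<Theta> \<phi> \<Longrightarrow> (\<And>y. wf_tm \<Theta> (\<sigma> y)) \<Longrightarrow> wf_fm \<Theta> (csubst n \<sigma> \<phi>)"
  by (induction \<phi> arbitrary: n \<sigma>) (auto simp: list_all_iff wf_subst_tm)

lemma fv_csubst: "fv (csubst n \<sigma> \<phi>) \<subseteq> (\<Union>y\<in>fv \<phi>. fv_tm (\<sigma> y))"
proof (induction \<phi> arbitrary: n \<sigma>)
  case (All x \<phi>)
  have "fv (csubst (Suc n) (\<sigma>(x := Var n)) \<phi>) \<subseteq> (\<Union>y\<in>fv \<phi>. fv_tm ((\<sigma>(x := Var n)) y))"
    by (rule All)
  also have "\<dots> \<subseteq> insert n (\<Union>y\<in>fv \<phi> - {x}. fv_tm (\<sigma> y))" by (auto split: if_splits)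
  finally show ?case by auto
next
  case (Ex x \<phi>)
  have "fv (csubst (Suc n) (\<sigma>(x := Var n)) \<phi>) \<subseteq> (\<Union>y\<in>fv \<phi>. fv_tm ((\<sigma>(x := Var n)) y))"
    by (rule Ex)
  also have "\<dots> \<subseteq> insert n (\<Union>y\<in>fv \<phi> - {x}. fv_tm (\<sigma> y))" by (auto split: if_splits)
  finally show ?case by auto
qed (simp_all add: fv_subst_tm UN_Un le_supI1 le_supI2)

text \<open>All binders of the result are at least n.\<close>

lemma free_for_csubst: "fv_tm t \<subseteq> {..<n} \<Longrightarrow> free_for t z (csubst n \<sigma> \<phi>)"
proof (induction \<phi> arbitrary: n \<sigma>)
  case (All x \<phi>)
  have "fv_tm t \<subseteq> {..<Suc n}" using All.prems by auto
  then show ?case using All by auto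
next
  case (Ex x \<phi>)
  have "fv_tm t \<subseteq> {..<Suc n}" using Ex.prems by auto
  then show ?case using Ex by auto
qed auto

text \<open>Both sides have the same binders, so variables introduced by \<tau> meet the same fate
  on both. At the binder n, the bound on \<sigma> keeps n out of the terms assigned to the other
  variables, so that \<tau> and its update at n agree on these.\<close>

lemma subst_csubst:
  "bounded_on (fv \<phi>) n \<sigma> \<Longrightarrow> subst_fm \<tau> (csubst n \<sigma> \<phi>) = csubst n (\<lambda>y. subst_tm \<tau> (\<sigma> y)) \<phi>"
proof (induction \<phi> arbitrary: n \<sigma> \<tau>)
  case (All x \<phi>)
  have "csubst (Suc n) (\<lambda>y. subst_tm (\<tau>(n := Var n)) ((\<sigma>(x := Var n)) y)) \<phi> =
      csubst (Suc n) ((\<lambda>y. subst_tm \<tau> (\<sigma> y))(x := Var n)) \<phi>"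
    using All.prems by (intro csubst_cong) (auto simp: bounded_on_def intro!: subst_tm_upd_fresh)
  then show ?case using All.IH[OF bounded_on_upd_Suc[of "fv \<phi>" x n \<sigma>]] All.prems
    by (simp del: fun_upd_apply)
next
  case (Ex x \<phi>)
  have "csubst (Suc n) (\<lambda>y. subst_tm (\<tau>(n := Var n)) ((\<sigma>(x := Var n)) y)) \<phi> =
      csubst (Suc n) ((\<lambda>y. subst_tm \<tau> (\<sigma> y))(x := Var n)) \<phi>"
    using Ex.prems by (intro csubst_cong) (auto simp: bounded_on_def intro!: subst_tm_upd_fresh)
  then show ?case using Ex.IH[OF bounded_on_upd_Suc[of "fv \<phi>" x n \<sigma>]] Ex.prems
    by (simp del: fun_upd_apply)
qed (auto simp: subst_tm_subst_tm)

text \<open>The variable i is a placeholder for the value of x: below k, so not one of the binders,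
  and absent from the values of the other variables. Instances of quantified formulas thus become
  values of \<open>csubst\<close>.\<close>

lemma subst1_csubst:
  assumes "bounded_on (fv \<phi> - {x}) k \<sigma>" "i < k" "\<forall>y\<in>fv \<phi> - {x}. i \<notin> fv_tm (\<sigma> y)"
  shows "subst1 (csubst k (\<sigma>(x := Var i)) \<phi>) i t = csubst k (\<sigma>(x := t)) \<phi>"
proof -
  have "subst1 (csubst k (\<sigma>(x := Var i)) \<phi>) i t =
      csubst k (\<lambda>y. subst_tm (Var(i := t)) ((\<sigma>(x := Var i)) y)) \<phi>"
    unfolding subst1_def using assms by (intro subst_csubst bounded_on_upd) auto
  also have "\<dots> = csubst k (\<sigma>(x := t)) \<phi>"
    using assms(3) by (intro csubst_cong) (auto simp: subst_tm_upd_fresh)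
  finally show ?thesis .
qed

section \<open>Values in the twist structure\<close>

context lfi_theory
begin

lemma in_For: "\<alpha> \<in> For \<Theta> \<longleftrightarrow> wf \<alpha>"
  by (simp add: For_def)

section \<open>Quantifier rules as inequalities\<close>

lemma And_provable: "\<turnstile> And \<alpha> \<beta> \<Longrightarrow> \<turnstile> \<alpha> \<and> \<turnstile> \<beta>"
  using And_leq1 And_leq2 leq_mp derives_wf by (metis wf_fm.simps(2))

lemma Iff_leq: "ax (Iff \<alpha> \<beta>) \<Longrightarrow> wf \<alpha> \<Longrightarrow> wf \<beta> \<Longrightarrow> \<alpha> \<preceq> \<beta> \<and> \<beta> \<preceq> \<alpha>"
  unfolding leq_def by (intro And_provable derives_ax) auto

lemma All_leq: "free_for t x \<phi> \<Longrightarrow> wf \<phi> \<Longrightarrow> wf_tm \<Theta> t \<Longrightarrow> All x \<phi> \<preceq> subst1 \<phi> x t"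
  by (intro leq_ax Ax13) (auto simp: wf_subst1)

lemma leq_Ex: "free_for t x \<phi> \<Longrightarrow> wf \<phi> \<Longrightarrow> wf_tm \<Theta> t \<Longrightarrow> subst1 \<phi> x t \<preceq> Ex x \<phi>"
  by (intro leq_ax Ax12) (auto simp: wf_subst1)

lemma leq_All: "\<alpha> \<preceq> \<phi> \<Longrightarrow> x \<notin> fv \<alpha> \<Longrightarrow> \<alpha> \<preceq> All x \<phi>"
  unfolding leq_def by (rule All_In)

lemma Ex_leq: "\<phi> \<preceq> \<alpha> \<Longrightarrow> x \<notin> fv \<alpha> \<Longrightarrow> Ex x \<phi> \<preceq> \<alpha>"
  unfolding leq_def by (rule Ex_In)

lemma All_mono: "\<phi> \<preceq> \<psi> \<Longrightarrow> All x \<phi> \<preceq> All x \<psi>"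
proof (rule leq_All)
  assume *: "\<phi> \<preceq> \<psi>"
  then have "All x \<phi> \<preceq> \<phi>" using All_leq[of "Var x" x \<phi>] leq_wf by (simp add: free_for_self)
  then show "All x \<phi> \<preceq> \<psi>" using * by (rule leq_trans)
qed simp

lemma Ex_mono: "\<phi> \<preceq> \<psi> \<Longrightarrow> Ex x \<phi> \<preceq> Ex x \<psi>"
proof (rule Ex_leq)
  assume *: "\<phi> \<preceq> \<psi>"
  then have "\<psi> \<preceq> Ex x \<psi>" using leq_Ex[of "Var x" x \<psi>] leq_wf by (simp add: free_for_self)
  with * show "\<phi> \<preceq> Ex x \<psi>" by (rule leq_trans)
qed simp

lemma provable_All: "\<turnstile> \<phi> \<Longrightarrow> \<turnstile> All x \<phi>"
proof -
  assume *: "\<turnstile> \<phi>"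
  \<comment> \<open>\<open>All_In\<close> acts on implications only; the antecedent is a theorem in
    which x is not free.\<close>
  let ?\<tau> = "Imp (All x \<phi>) (All x \<phi>)"
  have wf: "wf (All x \<phi>)" using derives_wf[OF *] by simp
  then have "?\<tau> \<preceq> All x \<phi>" using * by (intro leq_All provable_leq) auto
  moreover have "\<turnstile> ?\<tau>" using leq_refl[OF wf] by (simp add: leq_def)
  ultimately show ?thesis using leq_mp by simp
qed

lemma Neg_All_leq: "wf \<phi> \<Longrightarrow> Neg (All x \<phi>) \<preceq> Ex x (Neg \<phi>)"
  and leq_Neg_All: "wf \<phi> \<Longrightarrow> Ex x (Neg \<phi>) \<preceq> Neg (All x \<phi>)"
  using Iff_leq[OF Ax_neg_All, of x \<phi>] by auto

lemma Neg_Ex_leq: "wf \<phi> \<Longrightarrow> Neg (Ex x \<phi>) \<preceq> All x (Neg \<phi>)"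
  and leq_Neg_Ex: "wf \<phi> \<Longrightarrow> All x (Neg \<phi>) \<preceq> Neg (Ex x \<phi>)"
  using Iff_leq[OF Ax_neg_Ex, of x \<phi>] by auto

abbreviation algebra :: "('b + ('c, 'f, 'p) fm set) gorder" where
  "algebra \<equiv> lindenbaum.completion"

abbreviation principal :: "('c, 'f, 'p) fm \<Rightarrow> 'b + ('c, 'f, 'p) fm set" where
  "principal \<equiv> lindenbaum.principal"

text \<open>Provable equivalence is no congruence for \<open>Neg\<close> and \<open>Circ\<close>, hence a formula is
  represented by its class together with the class of its negation.\<close>

definition val :: "('c, 'f, 'p) fm \<Rightarrow> ('b + ('c, 'f, 'p) fm set) \<times> ('b + ('c, 'f, 'p) fm set)" where
  "val \<alpha> = (principal \<alpha>, principal (Neg \<alpha>))"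

definition eqv :: "('c, 'f, 'p) fm \<Rightarrow> ('c, 'f, 'p) fm \<Rightarrow> bool" (infix \<open>\<approx>\<close> 50) where
  "\<alpha> \<approx> \<beta> \<longleftrightarrow> \<alpha> \<preceq> \<beta> \<and> \<beta> \<preceq> \<alpha> \<and> Neg \<alpha> \<preceq> Neg \<beta> \<and> Neg \<beta> \<preceq> Neg \<alpha>"

lemma eqvI: "\<alpha> \<preceq> \<beta> \<Longrightarrow> \<beta> \<preceq> \<alpha> \<Longrightarrow> Neg \<alpha> \<preceq> Neg \<beta> \<Longrightarrow> Neg \<beta> \<preceq> Neg \<alpha> \<Longrightarrow> \<alpha> \<approx> \<beta>"
  by (simp add: eqv_def)

lemma eqvD: "\<alpha> \<approx> \<beta> \<Longrightarrow> \<alpha> \<preceq> \<beta>" "\<alpha> \<approx> \<beta> \<Longrightarrow> \<beta> \<preceq> \<alpha>"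
  "\<alpha> \<approx> \<beta> \<Longrightarrow> Neg \<alpha> \<preceq> Neg \<beta>" "\<alpha> \<approx> \<beta> \<Longrightarrow> Neg \<beta> \<preceq> Neg \<alpha>"
  by (simp_all add: eqv_def)

lemma eqv_refl: "wf \<alpha> \<Longrightarrow> \<alpha> \<approx> \<alpha>"
  by (simp add: eqv_def leq_refl)

lemma eqv_trans: "\<alpha> \<approx> \<beta> \<Longrightarrow> \<beta> \<approx> \<gamma> \<Longrightarrow> \<alpha> \<approx> \<gamma>"
  unfolding eqv_def by (meson leq_trans)

lemma eqv_wf: "\<alpha> \<approx> \<beta> \<Longrightarrow> wf \<alpha> \<and> wf \<beta>"
  unfolding eqv_def by (blast dest: leq_wf)

lemma principal_eq_iff: "wf \<alpha> \<Longrightarrow> wf \<beta> \<Longrightarrow> principal \<alpha> = principal \<beta> \<longleftrightarrow> \<alpha> \<preceq> \<beta> \<and> \<beta> \<preceq> \<alpha>"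
  by (simp add: lindenbaum.principal_eq_iff in_For)

text \<open>So \<open>eqv\<close> is the kernel of \<open>val\<close>. The type \<open>unit\<close>
  merely fixes the parameter of the algebra, which the left side does not mention.\<close>

lemma eqv_iff_val: "wf \<alpha> \<Longrightarrow> wf \<beta> \<Longrightarrow> \<alpha> \<approx> \<beta> \<longleftrightarrow> (val \<alpha> :: (unit + _) \<times> _) = val \<beta>"
  by (auto simp: eqv_def val_def principal_eq_iff)

lemma principal_eq_top_iff: "wf \<alpha> \<Longrightarrow> principal \<alpha> = \<top>\<^bsub>algebra\<^esub> \<longleftrightarrow> \<turnstile> \<alpha>"
proof
  assume wf: "wf \<alpha>"
  assume "principal \<alpha> = \<top>\<^bsub>algebra\<^esub>"
  then have "Imp \<alpha> \<alpha> \<preceq> \<alpha>"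
    using wf by (simp add: lindenbaum.principal_eq_top_iff in_For)
  moreover have "\<turnstile> Imp \<alpha> \<alpha>" using leq_refl[OF wf] by (simp add: leq_def)
  ultimately show "\<turnstile> \<alpha>" by (rule leq_mp[rotated])
next
  assume "wf \<alpha>" "\<turnstile> \<alpha>"
  then show "principal \<alpha> = \<top>\<^bsub>algebra\<^esub>"
    by (simp add: lindenbaum.principal_eq_top_iff in_For provable_leq)
qed

lemma meet_principal:
  "wf \<alpha> \<Longrightarrow> wf \<beta> \<Longrightarrow> principal \<alpha> \<sqinter>\<^bsub>algebra\<^esub> principal \<beta> = principal (And \<alpha> \<beta>)"
  by (simp add: lindenbaum.meet_principal in_For)

lemma join_principal:
  "wf \<alpha> \<Longrightarrow> wf \<beta> \<Longrightarrow> principal \<alpha> \<squnion>\<^bsub>algebra\<^esub> principal \<beta> = principal (Or \<alpha> \<beta>)"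
  by (rule lindenbaum.join_principal) (auto simp: in_For Or_leq_iff)

section \<open>Values respect the connectives\<close>

lemma val_Neg: "wf \<alpha> \<Longrightarrow> val (Neg \<alpha>) = tw_neg algebra (val \<alpha>)"
  using Iff_leq[OF dneg, of \<alpha>] by (simp add: val_def principal_eq_iff)

lemma val_And: "wf \<alpha> \<Longrightarrow> wf \<beta> \<Longrightarrow> val (And \<alpha> \<beta>) = tw_and algebra (val \<alpha>) (val \<beta>)"
  using Iff_leq[OF neg_And, of \<alpha> \<beta>] by (simp add: val_def meet_principal join_principal principal_eq_iff)

lemma val_Or: "wf \<alpha> \<Longrightarrow> wf \<beta> \<Longrightarrow> val (Or \<alpha> \<beta>) = tw_or algebra (val \<alpha>) (val \<beta>)"
  using Iff_leq[OF neg_Or, of \<alpha> \<beta>] by (simp add: val_def meet_principal join_principal principal_eq_iff)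

lemma compl_principal: "wf \<alpha> \<Longrightarrow> compl algebra (principal \<alpha>) = principal (Imp \<alpha> falsum)"
  by (simp add: lindenbaum.compl_principal in_For)

lemma leq_Imp: "wf \<alpha> \<Longrightarrow> wf \<beta> \<Longrightarrow> \<beta> \<preceq> Imp \<alpha> \<beta>"
  by (simp add: leq_ax A1)

text \<open>The operation \<open>bimp\<close> is defined from complement and join, so the first
  coordinate of the value of an implication rests on this classical equivalence.\<close>

lemma Imp_equiv_Or:
  assumes "wf \<alpha>" "wf \<beta>"
  shows "Or (Imp \<alpha> falsum) \<beta> \<preceq> Imp \<alpha> \<beta>" "Imp \<alpha> \<beta> \<preceq> Or (Imp \<alpha> falsum) \<beta>"
proof -
  have "And (Imp \<alpha> falsum) \<alpha> \<preceq> \<beta>"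
    using leq_trans[OF modus_ponens_leq falsum_leq] assms falsum_wf by simp
  then have "Imp \<alpha> falsum \<preceq> Imp \<alpha> \<beta>" using assms falsum_wf by (simp add: leq_Imp_iff)
  then show "Or (Imp \<alpha> falsum) \<beta> \<preceq> Imp \<alpha> \<beta>" using assms leq_Imp by (simp add: Or_leq)
  show "Imp \<alpha> \<beta> \<preceq> Or (Imp \<alpha> falsum) \<beta>"
  proof (rule leq_cases)
    show "Imp \<alpha> \<beta> \<preceq> Or \<alpha> (Imp \<alpha> falsum)" using assms falsum_wf by (simp add: excluded_middle)
    show "And (Imp \<alpha> \<beta>) \<alpha> \<preceq> Or (Imp \<alpha> falsum) \<beta>"
      using leq_trans[OF modus_ponens_leq leq_Or2] assms falsum_wf by simp
    show "And (Imp \<alpha> \<beta>) (Imp \<alpha> falsum) \<preceq> Or (Imp \<alpha> falsum) \<beta>"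
      using leq_trans[OF And_leq2 leq_Or1] assms falsum_wf by simp
  qed
qed

lemma val_Imp: "wf \<alpha> \<Longrightarrow> wf \<beta> \<Longrightarrow> val (Imp \<alpha> \<beta>) = tw_imp algebra (val \<alpha>) (val \<beta>)"
  using Iff_leq[OF neg_Imp, of \<alpha> \<beta>]
  by (simp add: val_def bimp_def compl_principal meet_principal join_principal principal_eq_iff
      Imp_equiv_Or falsum_wf)

lemma consistency_cases: "wf \<alpha> \<Longrightarrow> wf \<gamma> \<Longrightarrow> \<gamma> \<preceq> Or (Circ \<alpha>) (Neg (Circ \<alpha>))"
  by (simp add: provable_leq derives_ax A10)

lemma Neg_Circ_leq: "wf \<alpha> \<Longrightarrow> Neg (Circ \<alpha>) \<preceq> And \<alpha> (Neg \<alpha>)"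
  by (simp add: leq_ax ci)

lemma contradiction_Circ_leq:
  assumes "wf \<alpha>" "wf \<beta>"
  shows "And (And \<alpha> (Neg \<alpha>)) (Circ \<alpha>) \<preceq> \<beta>"
proof (rule leq_trans[OF _ explosion])
  show "And (And \<alpha> (Neg \<alpha>)) (Circ \<alpha>) \<preceq> And \<alpha> (And (Neg \<alpha>) (Circ \<alpha>))"
    using assms leq_refl[of "And (And \<alpha> (Neg \<alpha>)) (Circ \<alpha>)"] by (simp add: leq_And_iff)
qed (use assms in auto)

lemma leq_Neg_Circ: "wf \<alpha> \<Longrightarrow> And \<alpha> (Neg \<alpha>) \<preceq> Neg (Circ \<alpha>)"
  by (rule leq_cases[OF consistency_cases[of \<alpha>]]) (simp_all add: contradiction_Circ_leq And_leq2)

text \<open>The first coordinate of \<open>tw_circ\<close> is the complement of the contradiction.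
  In the second inequality the case \<open>Neg (Circ \<alpha>)\<close> yields that contradiction by
  \<open>ci\<close>.\<close>

lemma Circ_equiv:
  assumes "wf \<alpha>"
  shows "Circ \<alpha> \<preceq> Imp (And \<alpha> (Neg \<alpha>)) falsum" "Imp (And \<alpha> (Neg \<alpha>)) falsum \<preceq> Circ \<alpha>"
proof -
  let ?n = "And \<alpha> (Neg \<alpha>)"
  show "Circ \<alpha> \<preceq> Imp ?n falsum"
    using leq_trans[OF And_commute contradiction_Circ_leq] assms falsum_wf by (simp add: leq_Imp_iff)
  show "Imp ?n falsum \<preceq> Circ \<alpha>"
  proof (rule leq_cases[OF consistency_cases[of \<alpha>]])
    show "And (Imp ?n falsum) (Circ \<alpha>) \<preceq> Circ \<alpha>" using assms falsum_wf by (simp add: And_leq2)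
    have "And (Imp ?n falsum) (Neg (Circ \<alpha>)) \<preceq> And (Imp ?n falsum) ?n"
      using assms falsum_wf by (intro leq_And[OF And_leq1 leq_trans[OF And_leq2 Neg_Circ_leq]]) auto
    also have "And (Imp ?n falsum) ?n \<preceq> falsum" using assms falsum_wf by (simp add: modus_ponens_leq)
    finally show "And (Imp ?n falsum) (Neg (Circ \<alpha>)) \<preceq> Circ \<alpha>"
      by (rule leq_trans) (simp add: falsum_leq assms)
  qed (use assms falsum_wf in auto)
qed

lemma val_Circ:
  assumes "wf \<alpha>"
  shows "val (Circ \<alpha>) = tw_circ algebra (val \<alpha>)"
  using assms Circ_equiv[OF assms] Neg_Circ_leq[OF assms] leq_Neg_Circ[OF assms] falsum_wf
  by (simp add: val_def meet_principal compl_principal principal_eq_iff)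

lemmas val_simps = val_Neg val_And val_Or val_Imp val_Circ

lemma val_twist: "wf \<alpha> \<Longrightarrow> val \<alpha> \<in> twist algebra"
proof -
  assume wf: "wf \<alpha>"
  have "\<turnstile> Or \<alpha> (Neg \<alpha>)" using wf by (intro derives_ax A10) auto
  then show ?thesis
    using wf by (simp add: val_def twist_def in_For join_principal principal_eq_top_iff)
qed

text \<open>The negated halves pass through \<open>Ex x (Neg \<alpha>)\<close>, where the hypothesis
  on the negations applies; hence the need for \<open>Ax_neg_All\<close>.\<close>

lemma eqv_All:
  assumes "\<alpha> \<approx> \<beta>"
  shows "All x \<alpha> \<approx> All x \<beta>"
proof -
  have wf: "wf \<alpha>" "wf \<beta>" using eqv_wf[OF assms] by auto
  note e = eqvD[OF assms]
  show ?thesis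
    using wf leq_trans[OF leq_trans[OF Neg_All_leq Ex_mono[OF e(3)]] leq_Neg_All]
      leq_trans[OF leq_trans[OF Neg_All_leq Ex_mono[OF e(4)]] leq_Neg_All]
    by (intro eqvI All_mono e) auto
qed

lemma eqv_Ex:
  assumes "\<alpha> \<approx> \<beta>"
  shows "Ex x \<alpha> \<approx> Ex x \<beta>"
proof -
  have wf: "wf \<alpha>" "wf \<beta>" using eqv_wf[OF assms] by auto
  note e = eqvD[OF assms]
  show ?thesis
    using wf leq_trans[OF leq_trans[OF Neg_Ex_leq All_mono[OF e(3)]] leq_Neg_Ex]
      leq_trans[OF leq_trans[OF Neg_Ex_leq All_mono[OF e(4)]] leq_Neg_Ex]
    by (intro eqvI Ex_mono e) auto
qed

subsection \<open>Renaming of bound variables and instances of quantified formulas\<close>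

text \<open>As the kernel of a map that respects the connectives, \<open>eqv\<close> is a congruence
  for them.\<close>

lemma eqv_Neg: "\<alpha> \<approx> \<beta> \<Longrightarrow> Neg \<alpha> \<approx> Neg \<beta>"
  using eqv_wf[of \<alpha> \<beta>] by (simp add: eqv_iff_val val_simps)

lemma eqv_Circ: "\<alpha> \<approx> \<beta> \<Longrightarrow> Circ \<alpha> \<approx> Circ \<beta>"
  using eqv_wf[of \<alpha> \<beta>] by (simp add: eqv_iff_val val_simps)

lemma eqv_And: "\<alpha> \<approx> \<alpha>' \<Longrightarrow> \<beta> \<approx> \<beta>' \<Longrightarrow> And \<alpha> \<beta> \<approx> And \<alpha>' \<beta>'"
  using eqv_wf[of \<alpha> \<alpha>'] eqv_wf[of \<beta> \<beta>'] by (simp add: eqv_iff_val val_simps)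

lemma eqv_Or: "\<alpha> \<approx> \<alpha>' \<Longrightarrow> \<beta> \<approx> \<beta>' \<Longrightarrow> Or \<alpha> \<beta> \<approx> Or \<alpha>' \<beta>'"
  using eqv_wf[of \<alpha> \<alpha>'] eqv_wf[of \<beta> \<beta>'] by (simp add: eqv_iff_val val_simps)

lemma eqv_Imp: "\<alpha> \<approx> \<alpha>' \<Longrightarrow> \<beta> \<approx> \<beta>' \<Longrightarrow> Imp \<alpha> \<beta> \<approx> Imp \<alpha>' \<beta>'"
  using eqv_wf[of \<alpha> \<alpha>'] eqv_wf[of \<beta> \<beta>'] by (simp add: eqv_iff_val val_simps)

abbreviation wf_subst :: "(nat \<Rightarrow> ('c, 'f) tm) \<Rightarrow> bool" where
  "wf_subst \<sigma> \<equiv> \<forall>y. wf_tm \<Theta> (\<sigma> y)"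

definition fresh_for :: "nat \<Rightarrow> nat set \<Rightarrow> (nat \<Rightarrow> ('c, 'f) tm) \<Rightarrow> bool" where
  "fresh_for i V \<sigma> \<longleftrightarrow> (\<forall>y\<in>V. i \<notin> fv_tm (\<sigma> y))"

lemma bounded_on_fresh: "bounded_on V n \<sigma> \<Longrightarrow> n \<le> i \<Longrightarrow> fresh_for i V \<sigma>"
  by (fastforce simp: bounded_on_def fresh_for_def)

lemma fresh_csubst:
  assumes "fresh_for j (fv \<phi> - {x}) \<sigma>" "j \<noteq> i"
  shows "j \<notin> fv (csubst k (\<sigma>(x := Var i)) \<phi>)"
  using assms fv_csubst[of k "\<sigma>(x := Var i)" \<phi>] by (fastforce simp: fresh_for_def split: if_splits)

text \<open>Instantiate i by \<open>Var j\<close>, which is not captured since all inner binders are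
  at least k, then quantify over j, which is not free in the formula quantified over i.\<close>

lemma rename_leq:
  assumes "wf \<phi>" "wf_subst \<sigma>" "bounded_on (fv \<phi> - {x}) k \<sigma>" "i < k" "j < k"
    "fresh_for i (fv \<phi> - {x}) \<sigma>" "fresh_for j (fv \<phi> - {x}) \<sigma>"
  shows "All i (csubst k (\<sigma>(x := Var i)) \<phi>) \<preceq> All j (csubst k (\<sigma>(x := Var j)) \<phi>)"
    and "Ex j (csubst k (\<sigma>(x := Var j)) \<phi>) \<preceq> Ex i (csubst k (\<sigma>(x := Var i)) \<phi>)"
proof -
  let ?\<psi> = "\<lambda>i. csubst k (\<sigma>(x := Var i)) \<phi>"
  have wf: "wf (?\<psi> i)" for i using assms(1,2) by (intro wf_csubst) auto
  have fresh: "j \<notin> fv (All i (?\<psi> i))" "j \<notin> fv (Ex i (?\<psi> i))"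
    using fresh_csubst[OF assms(7)] by auto
  have eq: "subst1 (?\<psi> i) i (Var j) = ?\<psi> j"
    using assms by (intro subst1_csubst) (auto simp: fresh_for_def)
  have ff: "free_for (Var j) i (?\<psi> i)" using assms by (intro free_for_csubst) auto
  show "All i (?\<psi> i) \<preceq> All j (?\<psi> j)"
    using All_leq[OF ff wf] fresh(1) unfolding eq by (intro leq_All) auto
  show "Ex j (?\<psi> j) \<preceq> Ex i (?\<psi> i)"
    using leq_Ex[OF ff wf] fresh(2) unfolding eq by (intro Ex_leq) auto
qed

lemma rename_eqv:
  assumes "wf \<phi>" "wf_subst \<sigma>" "bounded_on (fv \<phi> - {x}) k \<sigma>" "i < k" "j < k"
    "fresh_for i (fv \<phi> - {x}) \<sigma>" "fresh_for j (fv \<phi> - {x}) \<sigma>"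
  shows "All i (csubst k (\<sigma>(x := Var i)) \<phi>) \<approx> All j (csubst k (\<sigma>(x := Var j)) \<phi>)"
    and "Ex i (csubst k (\<sigma>(x := Var i)) \<phi>) \<approx> Ex j (csubst k (\<sigma>(x := Var j)) \<phi>)"
proof -
  note a = rename_leq[OF assms] rename_leq[OF assms(1-3,5,4,7,6)]
  \<comment> \<open>Renaming in \<open>Neg \<phi>\<close> as well supplies the negated halves, since
    \<open>csubst\<close> commutes with \<open>Neg\<close>.\<close>
  have n: "wf (Neg \<phi>)" "bounded_on (fv (Neg \<phi>) - {x}) k \<sigma>"
    "fresh_for i (fv (Neg \<phi>) - {x}) \<sigma>" "fresh_for j (fv (Neg \<phi>) - {x}) \<sigma>"
    using assms by simp_all
  note b = rename_leq[OF n(1) assms(2) n(2) assms(4,5) n(3,4), unfolded csubst.simps]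
    rename_leq[OF n(1) assms(2) n(2) assms(5,4) n(4,3), unfolded csubst.simps]
  have wf: "wf (csubst k (\<sigma>(x := Var i)) \<phi>)" for i using assms(1,2) by (intro wf_csubst) auto
  show "All i (csubst k (\<sigma>(x := Var i)) \<phi>) \<approx> All j (csubst k (\<sigma>(x := Var j)) \<phi>)"
    by (intro eqvI a leq_trans[OF leq_trans[OF Neg_All_leq] leq_Neg_All] b wf)
  show "Ex i (csubst k (\<sigma>(x := Var i)) \<phi>) \<approx> Ex j (csubst k (\<sigma>(x := Var j)) \<phi>)"
    by (intro eqvI a leq_trans[OF leq_trans[OF Neg_Ex_leq] leq_Neg_Ex] b wf)
qed

text \<open>A quantifier takes two stages: the induction hypothesis raises the level of the body
  while its binder stays n, then \<open>rename_eqv\<close> changes that binder to m.\<close>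

lemma csubst_shift:
  "wf \<phi> \<Longrightarrow> wf_subst \<sigma> \<Longrightarrow> bounded_on (fv \<phi>) n \<sigma> \<Longrightarrow> n \<le> m \<Longrightarrow> csubst n \<sigma> \<phi> \<approx> csubst m \<sigma> \<phi>"
proof (induction \<phi> arbitrary: n m \<sigma>)
  case (Pred P ts)
  then have "wf (csubst n \<sigma> (Pred P ts))" by (intro wf_csubst) auto
  then show ?case using eqv_refl by simp
next
  case (All x \<phi>)
  have "csubst (Suc n) (\<sigma>(x := Var n)) \<phi> \<approx> csubst (Suc m) (\<sigma>(x := Var n)) \<phi>"
    using All.prems by (intro All.IH bounded_on_upd_Suc) auto
  then have "csubst n \<sigma> (All x \<phi>) \<approx> All n (csubst (Suc m) (\<sigma>(x := Var n)) \<phi>)"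
    by (simp add: eqv_All)
  moreover have "All n (csubst (Suc m) (\<sigma>(x := Var n)) \<phi>) \<approx> csubst m \<sigma> (All x \<phi>)"
    unfolding csubst.simps using All.prems
    by (intro rename_eqv) (auto elim: bounded_on_mono bounded_on_fresh)
  ultimately show ?case by (rule eqv_trans)
next
  case (Ex x \<phi>)
  have "csubst (Suc n) (\<sigma>(x := Var n)) \<phi> \<approx> csubst (Suc m) (\<sigma>(x := Var n)) \<phi>"
    using Ex.prems by (intro Ex.IH bounded_on_upd_Suc) auto
  then have "csubst n \<sigma> (Ex x \<phi>) \<approx> Ex n (csubst (Suc m) (\<sigma>(x := Var n)) \<phi>)"
    by (simp add: eqv_Ex)
  moreover have "Ex n (csubst (Suc m) (\<sigma>(x := Var n)) \<phi>) \<approx> csubst m \<sigma> (Ex x \<phi>)"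
    unfolding csubst.simps using Ex.prems
    by (intro rename_eqv) (auto elim: bounded_on_mono bounded_on_fresh)
  ultimately show ?case by (rule eqv_trans)
qed (simp_all add: eqv_Neg eqv_Circ eqv_And eqv_Or eqv_Imp)

lemma csubst_Var: "wf \<phi> \<Longrightarrow> \<exists>N. \<forall>n\<ge>N. \<phi> \<approx> csubst n Var \<phi>"
proof (induction \<phi>)
  case (Pred P ts)
  moreover have "map (subst_tm Var) ts = ts" by (simp add: map_idI)
  ultimately show ?case using eqv_refl by simp
next
  case (And \<phi> \<psi>)
  then obtain N M where "\<forall>n\<ge>N. \<phi> \<approx> csubst n Var \<phi>" "\<forall>n\<ge>M. \<psi> \<approx> csubst n Var \<psi>" by auto
  then show ?case by (intro exI[of _ "max N M"]) (simp add: eqv_And)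
next
  case (Or \<phi> \<psi>)
  then obtain N M where "\<forall>n\<ge>N. \<phi> \<approx> csubst n Var \<phi>" "\<forall>n\<ge>M. \<psi> \<approx> csubst n Var \<psi>" by auto
  then show ?case by (intro exI[of _ "max N M"]) (simp add: eqv_Or)
next
  case (Imp \<phi> \<psi>)
  then obtain N M where "\<forall>n\<ge>N. \<phi> \<approx> csubst n Var \<phi>" "\<forall>n\<ge>M. \<psi> \<approx> csubst n Var \<psi>" by auto
  then show ?case by (intro exI[of _ "max N M"]) (simp add: eqv_Imp)
next
  case (Neg \<phi>)
  then show ?case by (auto intro: eqv_Neg)
next
  case (Circ \<phi>)
  then show ?case by (auto intro: eqv_Circ)
next
  case (All x \<phi>)
  then obtain N where N: "\<forall>n\<ge>N. \<phi> \<approx> csubst n Var \<phi>" by auto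
  \<comment> \<open>Including x makes M exceed the old binder too, so that x can be renamed to n at
    level \<open>Suc n\<close>.\<close>
  obtain M where M: "bounded_on (insert x (fv \<phi>)) M (Var :: nat \<Rightarrow> ('c, 'f) tm)"
    using bounded_on_exists[of "insert x (fv \<phi>)"] by auto
  have "All x \<phi> \<approx> csubst n Var (All x \<phi>)" if n: "n \<ge> max N M" for n
  proof (rule eqv_trans)
    show "All x \<phi> \<approx> All x (csubst (Suc n) (Var(x := Var x)) \<phi>)"
      using N n by (simp add: eqv_All)
    show "All x (csubst (Suc n) (Var(x := Var x)) \<phi>) \<approx> csubst n Var (All x \<phi>)"
      unfolding csubst.simps using All.prems M n
      by (intro rename_eqv) (auto simp: bounded_on_def fresh_for_def)
  qed
  then show ?case by blast
next
  case (Ex x \<phi>)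
  then obtain N where N: "\<forall>n\<ge>N. \<phi> \<approx> csubst n Var \<phi>" by auto
  obtain M where M: "bounded_on (insert x (fv \<phi>)) M (Var :: nat \<Rightarrow> ('c, 'f) tm)"
    using bounded_on_exists[of "insert x (fv \<phi>)"] by auto
  have "Ex x \<phi> \<approx> csubst n Var (Ex x \<phi>)" if n: "n \<ge> max N M" for n
  proof (rule eqv_trans)
    show "Ex x \<phi> \<approx> Ex x (csubst (Suc n) (Var(x := Var x)) \<phi>)"
      using N n by (simp add: eqv_Ex)
    show "Ex x (csubst (Suc n) (Var(x := Var x)) \<phi>) \<approx> csubst n Var (Ex x \<phi>)"
      unfolding csubst.simps using Ex.prems M n
      by (intro rename_eqv) (auto simp: bounded_on_def fresh_for_def)
  qed
  then show ?case by blast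
qed

text \<open>Both sides are moved to a level that also exceeds the variables of t; there the
  quantifier axiom applies without capture.\<close>

lemma csubst_instance:
  assumes "wf \<phi>" "wf_subst \<sigma>" "wf_tm \<Theta> t" "bounded_on (fv \<phi> - {x}) n \<sigma>"
    "bounded_on (fv \<phi>) m (\<sigma>(x := t))"
  shows "csubst n \<sigma> (All x \<phi>) \<preceq> csubst m (\<sigma>(x := t)) \<phi>"
    and "csubst m (\<sigma>(x := t)) \<phi> \<preceq> csubst n \<sigma> (Ex x \<phi>)"
proof -
  obtain l where "fv_tm t \<subseteq> {..<l}" using bounded_nat_set by fastforce
  define k where "k = max l (max n m)"
  have k: "n \<le> k" "m \<le> Suc k" "fv_tm t \<subseteq> {..<Suc k}"
    using \<open>fv_tm t \<subseteq> {..<l}\<close> by (auto simp: k_def)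
  let ?\<psi> = "csubst (Suc k) (\<sigma>(x := Var k)) \<phi>"
  have wf: "wf ?\<psi>" using assms by (intro wf_csubst) auto
  have eq: "subst1 ?\<psi> k t = csubst (Suc k) (\<sigma>(x := t)) \<phi>"
    using assms k bounded_on_fresh[OF assms(4) k(1)]
    by (intro subst1_csubst) (auto simp: fresh_for_def intro: bounded_on_mono)
  have shift: "csubst m (\<sigma>(x := t)) \<phi> \<approx> csubst (Suc k) (\<sigma>(x := t)) \<phi>"
    using assms k by (intro csubst_shift) auto
  have "csubst n \<sigma> (All x \<phi>) \<approx> csubst k \<sigma> (All x \<phi>)"
    using assms k by (intro csubst_shift) auto
  then have "csubst n \<sigma> (All x \<phi>) \<preceq> All k ?\<psi>" by (simp add: eqvD)
  also have "All k ?\<psi> \<preceq> csubst (Suc k) (\<sigma>(x := t)) \<phi>"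
    unfolding eq[symmetric] using k(3) wf assms(3) by (intro All_leq free_for_csubst)
  also have "csubst (Suc k) (\<sigma>(x := t)) \<phi> \<preceq> csubst m (\<sigma>(x := t)) \<phi>"
    using shift by (rule eqvD)
  finally show "csubst n \<sigma> (All x \<phi>) \<preceq> csubst m (\<sigma>(x := t)) \<phi>" .
  have "csubst m (\<sigma>(x := t)) \<phi> \<preceq> csubst (Suc k) (\<sigma>(x := t)) \<phi>"
    using shift by (rule eqvD)
  also have "csubst (Suc k) (\<sigma>(x := t)) \<phi> \<preceq> Ex k ?\<psi>"
    unfolding eq[symmetric] using k(3) wf assms(3) by (intro leq_Ex free_for_csubst)
  also have "Ex k ?\<psi> \<preceq> csubst n \<sigma> (Ex x \<phi>)"
  proof -
    have "csubst n \<sigma> (Ex x \<phi>) \<approx> csubst k \<sigma> (Ex x \<phi>)"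
      using assms k by (intro csubst_shift) auto
    then show ?thesis by (simp add: eqvD)
  qed
  finally show "csubst m (\<sigma>(x := t)) \<phi> \<preceq> csubst n \<sigma> (Ex x \<phi>)" .
qed

text \<open>Every admissible level m is allowed, which avoids choosing one for each term; by
  \<open>csubst_shift\<close> the level does not affect the value.\<close>

definition instances :: "(nat \<Rightarrow> ('c, 'f) tm) \<Rightarrow> nat \<Rightarrow> ('c, 'f, 'p) fm \<Rightarrow> ('c, 'f, 'p) fm set" where
  "instances \<sigma> x \<phi> =
     {csubst m (\<sigma>(x := t)) \<phi> | t m. wf_tm \<Theta> t \<and> bounded_on (fv \<phi>) m (\<sigma>(x := t))}"

section \<open>Quantified formulas as bounds of their instances\<close>

lemma wf_instances: "wf \<phi> \<Longrightarrow> wf_subst \<sigma> \<Longrightarrow> instances \<sigma> x \<phi> \<subseteq> For \<Theta>"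
  by (auto simp: instances_def in_For intro!: wf_csubst)

text \<open>Provides the eigenvariable: k lies above n and above all variables of the bound
  \<alpha>.\<close>

lemma quantifier_bound_instance:
  assumes "wf \<phi>" "wf_subst \<sigma>" "bounded_on (fv \<phi> - {x}) n \<sigma>" "wf \<alpha>"
  obtains k where "k \<notin> fv \<alpha>" "csubst (Suc k) (\<sigma>(x := Var k)) \<phi> \<in> instances \<sigma> x \<phi>" "n \<le> k"
proof -
  obtain l where "fv \<alpha> \<subseteq> {..<l}" using bounded_nat_set by fastforce
  define k where "k = max n l"
  have "bounded_on (fv \<phi>) (Suc k) (\<sigma>(x := Var k))"
    using assms by (intro bounded_on_upd_Suc) (auto simp: k_def elim: bounded_on_mono)
  then have "csubst (Suc k) (\<sigma>(x := Var k)) \<phi> \<in> instances \<sigma> x \<phi>"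
    unfolding instances_def by (intro CollectI exI[of _ "Var k"] exI[of _ "Suc k"]) auto
  moreover have "k \<notin> fv \<alpha>" using \<open>fv \<alpha> \<subseteq> {..<l}\<close> by (auto simp: k_def)
  ultimately show thesis using that k_def by auto
qed

lemma csubst_All_greatest:
  assumes "wf \<phi>" "wf_subst \<sigma>" "bounded_on (fv \<phi> - {x}) n \<sigma>" "wf \<alpha>"
  shows "\<alpha> \<preceq> csubst n \<sigma> (All x \<phi>) \<longleftrightarrow> (\<forall>\<psi>\<in>instances \<sigma> x \<phi>. \<alpha> \<preceq> \<psi>)"
proof
  assume "\<alpha> \<preceq> csubst n \<sigma> (All x \<phi>)"
  then show "\<forall>\<psi>\<in>instances \<sigma> x \<phi>. \<alpha> \<preceq> \<psi>"
    using assms by (auto simp: instances_def simp del: csubst.simps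
        intro: leq_trans[OF _ csubst_instance(1)])
next
  assume *: "\<forall>\<psi>\<in>instances \<sigma> x \<phi>. \<alpha> \<preceq> \<psi>"
  obtain k where k: "k \<notin> fv \<alpha>" "csubst (Suc k) (\<sigma>(x := Var k)) \<phi> \<in> instances \<sigma> x \<phi>" "n \<le> k"
    using quantifier_bound_instance[OF assms] .
  \<comment> \<open>By definition the right side is \<open>All k\<close> applied to the generic
    instance just chosen.\<close>
  have "\<alpha> \<preceq> csubst k \<sigma> (All x \<phi>)" using * k by (auto intro: leq_All)
  moreover have "csubst n \<sigma> (All x \<phi>) \<approx> csubst k \<sigma> (All x \<phi>)"
    using assms k by (intro csubst_shift) auto
  ultimately show "\<alpha> \<preceq> csubst n \<sigma> (All x \<phi>)" by (blast intro: leq_trans eqvD(2))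
qed

lemma csubst_Ex_least:
  assumes "wf \<phi>" "wf_subst \<sigma>" "bounded_on (fv \<phi> - {x}) n \<sigma>" "wf \<alpha>"
  shows "csubst n \<sigma> (Ex x \<phi>) \<preceq> \<alpha> \<longleftrightarrow> (\<forall>\<psi>\<in>instances \<sigma> x \<phi>. \<psi> \<preceq> \<alpha>)"
proof
  assume "csubst n \<sigma> (Ex x \<phi>) \<preceq> \<alpha>"
  then show "\<forall>\<psi>\<in>instances \<sigma> x \<phi>. \<psi> \<preceq> \<alpha>"
    using assms by (auto simp: instances_def simp del: csubst.simps
        intro: leq_trans[OF csubst_instance(2)])
next
  assume *: "\<forall>\<psi>\<in>instances \<sigma> x \<phi>. \<psi> \<preceq> \<alpha>"
  obtain k where k: "k \<notin> fv \<alpha>" "csubst (Suc k) (\<sigma>(x := Var k)) \<phi> \<in> instances \<sigma> x \<phi>" "n \<le> k"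
    using quantifier_bound_instance[OF assms] .
  have "csubst k \<sigma> (Ex x \<phi>) \<preceq> \<alpha>" using * k by (auto intro: Ex_leq)
  moreover have "csubst n \<sigma> (Ex x \<phi>) \<approx> csubst k \<sigma> (Ex x \<phi>)"
    using assms k by (intro csubst_shift) auto
  ultimately show "csubst n \<sigma> (Ex x \<phi>) \<preceq> \<alpha>" by (blast intro: leq_trans eqvD(1))
qed

lemma inf_instances:
  assumes "wf \<phi>" "wf_subst \<sigma>" "bounded_on (fv \<phi> - {x}) n \<sigma>"
  shows "\<Sqinter>\<^bsub>algebra\<^esub> (principal ` instances \<sigma> x \<phi>) = principal (csubst n \<sigma> (All x \<phi>))"
proof (rule lindenbaum.inf_principal)
  show "csubst n \<sigma> (All x \<phi>) \<in> For \<Theta>" unfolding in_For using assms by (intro wf_csubst) auto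
  show "instances \<sigma> x \<phi> \<subseteq> For \<Theta>" using assms by (intro wf_instances)
qed (use assms csubst_All_greatest in_For in blast)

lemma sup_instances:
  assumes "wf \<phi>" "wf_subst \<sigma>" "bounded_on (fv \<phi> - {x}) n \<sigma>"
  shows "\<Squnion>\<^bsub>algebra\<^esub> (principal ` instances \<sigma> x \<phi>) = principal (csubst n \<sigma> (Ex x \<phi>))"
proof (rule lindenbaum.sup_principal)
  show "csubst n \<sigma> (Ex x \<phi>) \<in> For \<Theta>" unfolding in_For using assms by (intro wf_csubst) auto
  show "instances \<sigma> x \<phi> \<subseteq> For \<Theta>" using assms by (intro wf_instances)
qed (use assms csubst_Ex_least in_For in blast)

end

section \<open>The term model\<close>

text \<open>Terms serve as individuals; they are coded as atomic formulas to fit into the universe.\<close>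

definition tm_code :: "('c, 'f) tm \<Rightarrow> 'u + ('c, 'f, 'p) fm" where
  "tm_code t = Inr (Pred undefined [t])"

lemma inj_tm_code: "inj tm_code"
  by (simp add: inj_def tm_code_def)

lemma inv_tm_code [simp]: "inv tm_code (tm_code t) = t"
  by (simp add: inj_tm_code)

text \<open>Each term \<open>\<rho> y\<close> contains no variable other than y, so \<rho> cannot
  cause capture. Replacing all variables but one by constants is of this kind.\<close>

lemma subst_fm_subst_fm:
  assumes "\<And>y. fv_tm (\<rho> y) \<subseteq> {y}"
  shows "subst_fm \<tau> (subst_fm \<rho> \<phi>) = subst_fm (\<lambda>y. subst_tm \<tau> (\<rho> y)) \<phi>"
  using assms
proof (induction \<phi> arbitrary: \<tau> \<rho>)
  case (All x \<phi>)
  have *: "(\<lambda>y. subst_tm (\<tau>(x := Var x)) ((\<rho>(x := Var x)) y)) = (\<lambda>y. subst_tm \<tau> (\<rho> y))(x := Var x)"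
    using All.prems by (intro ext) (auto intro!: subst_tm_upd_fresh)
  have "subst_fm (\<tau>(x := Var x)) (subst_fm (\<rho>(x := Var x)) \<phi>) =
      subst_fm ((\<lambda>y. subst_tm \<tau> (\<rho> y))(x := Var x)) \<phi>"
    unfolding *[symmetric] using All.prems by (intro All.IH) auto
  then show ?case by simp
next
  case (Ex x \<phi>)
  have *: "(\<lambda>y. subst_tm (\<tau>(x := Var x)) ((\<rho>(x := Var x)) y)) = (\<lambda>y. subst_tm \<tau> (\<rho> y))(x := Var x)"
    using Ex.prems by (intro ext) (auto intro!: subst_tm_upd_fresh)
  have "subst_fm (\<tau>(x := Var x)) (subst_fm (\<rho>(x := Var x)) \<phi>) =
      subst_fm ((\<lambda>y. subst_tm \<tau> (\<rho> y))(x := Var x)) \<phi>"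
    unfolding *[symmetric] using Ex.prems by (intro Ex.IH) auto
  then show ?case by simp
qed (simp_all add: subst_tm_subst_tm)

text \<open>\<open>interp\<close> inserts the name of an individual into a body that is already
  grounded elsewhere; this turns the insertion into an update of the assignment.\<close>

lemma subst1_ground:
  "subst1 (subst_fm ((\<lambda>y. Cst (Inr (\<mu> y)))(x := Var x)) (map_fm Inl id id \<phi>)) x (Cst (Inr a)) =
    ground (\<mu>(x := a)) \<phi>"
  unfolding subst1_def ground_def
  by (subst subst_fm_subst_fm) (auto intro!: arg_cong[where f = "\<lambda>\<sigma>. subst_fm \<sigma> _"])

lemma ground_simps:
  "ground \<mu> (And \<phi> \<psi>) = And (ground \<mu> \<phi>) (ground \<mu> \<psi>)"
  "ground \<mu> (Or \<phi> \<psi>) = Or (ground \<mu> \<phi>) (ground \<mu> \<psi>)"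
  "ground \<mu> (Imp \<phi> \<psi>) = Imp (ground \<mu> \<phi>) (ground \<mu> \<psi>)"
  "ground \<mu> (Neg \<phi>) = Neg (ground \<mu> \<phi>)"
  "ground \<mu> (Circ \<phi>) = Circ (ground \<mu> \<phi>)"
  by (simp_all add: ground_def)

lemma interp_ground_All:
  "interp A M (ground \<mu> (All x \<phi>)) =
    (\<Sqinter>\<^bsub>A\<^esub> (fst ` (\<lambda>a. interp A M (ground (\<mu>(x := a)) \<phi>)) ` dom M),
     \<Squnion>\<^bsub>A\<^esub> (snd ` (\<lambda>a. interp A M (ground (\<mu>(x := a)) \<phi>)) ` dom M))"
  by (simp add: ground_def[of _ "All _ _"] subst1_ground image_image del: fun_upd_apply)

lemma interp_ground_Ex:
  "interp A M (ground \<mu> (Ex x \<phi>)) =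
    (\<Squnion>\<^bsub>A\<^esub> (fst ` (\<lambda>a. interp A M (ground (\<mu>(x := a)) \<phi>)) ` dom M),
     \<Sqinter>\<^bsub>A\<^esub> (snd ` (\<lambda>a. interp A M (ground (\<mu>(x := a)) \<phi>)) ` dom M))"
  by (simp add: ground_def[of _ "Ex _ _"] subst1_ground image_image del: fun_upd_apply)

context lfi_theory
begin

text \<open>Premises may be open and must hold under every assignment. One free variable at a time
  is generalized, which lowers the number of free variables, and then instantiated at its value
  under \<sigma>.\<close>

lemma provable_csubst:
  "\<turnstile> \<phi> \<Longrightarrow> wf_subst \<sigma> \<Longrightarrow> bounded_on (fv \<phi>) n \<sigma> \<Longrightarrow> \<turnstile> csubst n \<sigma> \<phi>"
proof (induction "card (fv \<phi>)" arbitrary: \<phi>)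
  case 0
  then have empty: "fv \<phi> = {}" and wf: "wf \<phi>" by (auto dest: derives_wf)
  obtain N where "\<forall>m\<ge>N. \<phi> \<approx> csubst m Var \<phi>" using csubst_Var[OF wf] by blast
  then have "\<phi> \<approx> csubst (max N n) Var \<phi>" by simp
  moreover have "csubst n Var \<phi> \<approx> csubst (max N n) Var \<phi>"
    using wf empty by (intro csubst_shift) (auto simp: bounded_on_def)
  ultimately have "\<turnstile> csubst n Var \<phi>" using 0 by (meson eqvD leq_mp)
  then show ?case using csubst_cong[of \<phi> \<sigma> Var n] empty by simp
next
  case (Suc k)
  then obtain x where x: "x \<in> fv \<phi>" by fastforce
  then have card: "k = card (fv (All x \<phi>))" using Suc.hyps(2) by simp
  have "\<turnstile> csubst n \<sigma> (All x \<phi>)"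
    using Suc.prems by (intro Suc.hyps(1)[OF card] provable_All) (auto simp: bounded_on_def)
  moreover have "csubst n \<sigma> (All x \<phi>) \<preceq> csubst n (\<sigma>(x := \<sigma> x)) \<phi>"
    using Suc.prems by (intro csubst_instance) (auto simp: bounded_on_def dest: derives_wf)
  ultimately show ?case by (auto dest: leq_mp)
qed

lemma provable_csubst_Var:
  assumes "wf \<phi>"
    and *: "\<And>n. bounded_on (fv \<phi>) n (Var :: nat \<Rightarrow> ('c, 'f) tm) \<Longrightarrow> \<turnstile> csubst n Var \<phi>"
  shows "\<turnstile> \<phi>"
proof -
  obtain N where N: "\<forall>m\<ge>N. \<phi> \<approx> csubst m Var \<phi>" using csubst_Var[OF assms(1)] by blast
  obtain n where "bounded_on (fv \<phi>) n (Var :: nat \<Rightarrow> ('c, 'f) tm)"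
    using bounded_on_exists finite_fv by blast
  then have "\<turnstile> csubst (max n N) Var \<phi>" by (intro *) (erule bounded_on_mono, simp)
  moreover have "csubst (max n N) Var \<phi> \<preceq> \<phi>" using N by (simp add: eqvD)
  ultimately show "\<turnstile> \<phi>" by (rule leq_mp)
qed

text \<open>Open terms are individuals too, so that assignments correspond to substitutions and the
  identity substitution is among them.\<close>

definition term_model ::
  "('c, 'f, 'p, 'u + ('c, 'f, 'p) fm, 'b + ('c, 'f, 'p) fm set) struct" where
  "term_model = \<lparr>dom = tm_code ` {t. wf_tm \<Theta> t},
     cst = \<lambda>c. tm_code (Cst c),
     fn = \<lambda>f us. tm_code (Fn f (map (inv tm_code) us)),
     prd = \<lambda>P us. val (Pred P (map (inv tm_code) us))\<rparr>"

lemma term_model_simps [simp]: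
  "dom term_model = tm_code ` {t. wf_tm \<Theta> t}"
  "cst term_model c = tm_code (Cst c)"
  "fn term_model f us = tm_code (Fn f (map (inv tm_code) us))"
  "prd term_model P us = val (Pred P (map (inv tm_code) us))"
  by (simp_all add: term_model_def)

lemma is_struct_term_model: "is_struct algebra \<Theta> term_model"
  unfolding is_struct_def
proof (intro conjI ballI impI)
  have "wf_tm \<Theta> (Var 0)" by simp
  then show "dom term_model \<noteq> {}" by (simp only: term_model_simps) blast
next
  fix us :: "('u + ('c, 'f, 'p) fm) list"
  assume "us \<in> lists (dom term_model)"
  then obtain ts where us: "us = map tm_code ts" and ts: "list_all (wf_tm \<Theta>) ts"
    by (auto simp: lists_image list_all_iff)
  then have "map (inv tm_code) us = ts" by (simp add: map_idI)
  assume "us \<noteq> []"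
  then have ne: "ts \<noteq> []" using us by simp
  show "fn term_model f us \<in> dom term_model" if "f \<in> Funs \<Theta> (length us)" for f
    using that ts ne us \<open>map (inv tm_code) us = ts\<close> by (simp del: map_map)
  show "prd term_model P us \<in> twist algebra" if "P \<in> Preds \<Theta> (length us)" for P
    using that ts ne us \<open>map (inv tm_code) us = ts\<close> by (simp add: val_twist del: map_map)
qed auto

section \<open>Interpretation in the term model\<close>

lemma tval_term_model:
  "tval term_model (subst_tm (\<lambda>y. Cst (Inr ((tm_code \<circ> \<sigma>) y))) (map_tm Inl id t)) =
    tm_code (subst_tm \<sigma> t)"
  by (induction t) (auto simp: comp_def cong: map_cong)

text \<open>F abstracts the interpretation of the body as a function of the assignment, so that both
  quantifiers can use the lemma inside the induction.\<close>

lemma image_dom_term_model: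
  assumes IH: "\<And>\<sigma> n. wf_subst \<sigma> \<Longrightarrow> bounded_on (fv \<phi>) n \<sigma> \<Longrightarrow>
      F (tm_code \<circ> \<sigma>) = val (csubst n \<sigma> \<phi>)"
    and wf: "wf_subst \<sigma>"
  shows "(\<lambda>a. F ((tm_code \<circ> \<sigma>)(x := a))) ` dom term_model = val ` instances \<sigma> x \<phi>" (is "?L = ?R")
proof -
  have F: "F ((tm_code \<circ> \<sigma>)(x := tm_code t)) = val (csubst n (\<sigma>(x := t)) \<phi>)"
    if "wf_tm \<Theta> t" "bounded_on (fv \<phi>) n (\<sigma>(x := t))" for n t
    using IH[of "\<sigma>(x := t)" n] that wf by (simp add: fun_upd_comp)
  show ?thesis
  proof
    show "?L \<subseteq> ?R"
    proof clarsimp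
      fix t assume t: "wf_tm \<Theta> t"
      obtain n where n: "bounded_on (fv \<phi>) n (\<sigma>(x := t))" using bounded_on_exists finite_fv by blast
      then have "csubst n (\<sigma>(x := t)) \<phi> \<in> instances \<sigma> x \<phi>" using t by (auto simp: instances_def)
      then show "F ((tm_code \<circ> \<sigma>)(x := tm_code t)) \<in> ?R" using F[OF t n] by simp
    qed
    show "?R \<subseteq> ?L" using F by (force simp: instances_def)
  qed
qed

lemma instances_Neg: "instances \<sigma> x (Neg \<phi>) = Neg ` instances \<sigma> x \<phi>"
  by (auto simp: instances_def)

lemma fst_val: "fst ` val ` S = principal ` S" and snd_val: "snd ` val ` S = principal ` Neg ` S"
  by (simp_all add: val_def image_image)

text \<open>Second coordinates of quantified values are bounds of negated instances; this identifies
  them with the class of the negated quantified formula.\<close>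

lemma principal_Neg_All: "wf \<phi> \<Longrightarrow> principal (Neg (All x \<phi>)) = principal (Ex x (Neg \<phi>))"
  and principal_Neg_Ex: "wf \<phi> \<Longrightarrow> principal (Neg (Ex x \<phi>)) = principal (All x (Neg \<phi>))"
  by (simp_all add: principal_eq_iff Neg_All_leq leq_Neg_All Neg_Ex_leq leq_Neg_Ex)

text \<open>The truth lemma. The level n is arbitrary because each term instance in a quantifier
  case brings its own level.\<close>

lemma interp_term_model:
  fixes M :: "('c, 'f, 'p, 'u + ('c, 'f, 'p) fm, 'b + ('c, 'f, 'p) fm set) struct"
  defines "M \<equiv> term_model"
  shows "wf \<phi> \<Longrightarrow> wf_subst \<sigma> \<Longrightarrow> bounded_on (fv \<phi>) n \<sigma> \<Longrightarrow>
    interp algebra M (ground (tm_code \<circ> \<sigma>) \<phi>) = val (csubst n \<sigma> \<phi>)"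
proof (induction \<phi> arbitrary: \<sigma> n)
  case (Pred P ts)
  then show ?case
    by (simp add: M_def ground_def tval_term_model[unfolded comp_def] comp_def)
next
  case (All x \<phi>)
  have wf: "wf \<phi>" "wf_subst \<sigma>" "bounded_on (fv \<phi> - {x}) n \<sigma>" using All.prems by auto
  then have wf': "wf (Neg \<phi>)" "bounded_on (fv (Neg \<phi>) - {x}) n \<sigma>" by auto
  have image: "(\<lambda>a. interp algebra M (ground ((tm_code \<circ> \<sigma>)(x := a)) \<phi>)) ` dom M =
      val ` instances \<sigma> x \<phi>"
    unfolding M_def by (intro image_dom_term_model All.IH[unfolded M_def] wf)
  have "wf (csubst (Suc n) (\<sigma>(x := Var n)) \<phi>)" using wf by (intro wf_csubst) auto
  then show ?case
    unfolding interp_ground_All image fst_val snd_val instances_Neg[symmetric]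
    by (simp add: val_def principal_Neg_All inf_instances[OF wf]
        sup_instances[OF wf'(1) wf(2) wf'(2)])
next
  case (Ex x \<phi>)
  have wf: "wf \<phi>" "wf_subst \<sigma>" "bounded_on (fv \<phi> - {x}) n \<sigma>" using Ex.prems by auto
  then have wf': "wf (Neg \<phi>)" "bounded_on (fv (Neg \<phi>) - {x}) n \<sigma>" by auto
  have image: "(\<lambda>a. interp algebra M (ground ((tm_code \<circ> \<sigma>)(x := a)) \<phi>)) ` dom M =
      val ` instances \<sigma> x \<phi>"
    unfolding M_def by (intro image_dom_term_model Ex.IH[unfolded M_def] wf)
  have "wf (csubst (Suc n) (\<sigma>(x := Var n)) \<phi>)" using wf by (intro wf_csubst) auto
  then show ?case
    unfolding interp_ground_Ex image fst_val snd_val instances_Neg[symmetric]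
    by (simp add: val_def principal_Neg_Ex sup_instances[OF wf]
        inf_instances[OF wf'(1) wf(2) wf'(2)])
next
  case (And \<phi> \<psi>)
  from And.IH[of \<sigma> n] And.prems show ?case
    by (simp add: ground_simps val_simps wf_csubst)
next
  case (Or \<phi> \<psi>)
  from Or.IH[of \<sigma> n] Or.prems show ?case
    by (simp add: ground_simps val_simps wf_csubst)
next
  case (Imp \<phi> \<psi>)
  from Imp.IH[of \<sigma> n] Imp.prems show ?case
    by (simp add: ground_simps val_simps wf_csubst)
next
  case (Neg \<phi>)
  from Neg.IH[of \<sigma> n] Neg.prems show ?case
    by (simp add: ground_simps val_simps wf_csubst)
next
  case (Circ \<phi>)
  from Circ.IH[of \<sigma> n] Circ.prems show ?case
    by (simp add: ground_simps val_simps wf_csubst)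
qed

lemma val_designated: "wf \<alpha> \<Longrightarrow> val \<alpha> \<in> designated algebra \<longleftrightarrow> \<turnstile> \<alpha>"
  by (simp add: designated_def split_beta val_twist) (simp add: val_def principal_eq_top_iff)

text \<open>Derivable formulas hold under every assignment by \<open>provable_csubst\<close>;
  conversely the assignment of each variable to itself already recovers derivability.\<close>

lemma holds_in_term_model:
  fixes M :: "('c, 'f, 'p, 'u + ('c, 'f, 'p) fm, 'b + ('c, 'f, 'p) fm set) struct"
  defines "M \<equiv> term_model"
  assumes "wf \<phi>"
  shows "holds_in algebra M \<phi> \<longleftrightarrow> \<turnstile> \<phi>"
proof
  assume *: "\<turnstile> \<phi>"
  show "holds_in algebra M \<phi>"
    unfolding holds_in_def
  proof (intro allI impI)
    fix \<mu> :: "nat \<Rightarrow> 'u + ('c, 'f, 'p) fm"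
    assume \<mu>: "range \<mu> \<subseteq> dom M"
    define \<sigma> :: "nat \<Rightarrow> ('c, 'f) tm" where "\<sigma> = inv tm_code \<circ> \<mu>"
    have "\<mu> y = tm_code (\<sigma> y) \<and> wf_tm \<Theta> (\<sigma> y)" for y
      using subsetD[OF \<mu>, of "\<mu> y"] by (auto simp: \<sigma>_def M_def)
    then have \<sigma>: "\<mu> = tm_code \<circ> \<sigma>" "wf_subst \<sigma>" by auto
    obtain n where n: "bounded_on (fv \<phi>) n \<sigma>" using bounded_on_exists finite_fv by blast
    have "wf (csubst n \<sigma> \<phi>)" using assms(2) \<sigma>(2) by (intro wf_csubst) auto
    then show "interp algebra M (ground \<mu> \<phi>) \<in> designated algebra"
      unfolding \<sigma>(1) M_def interp_term_model[OF assms(2) \<sigma>(2) n]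
      by (simp add: val_designated provable_csubst[OF * \<sigma>(2) n])
  qed
next
  assume *: "holds_in algebra M \<phi>"
  have wf: "wf_subst Var" by simp
  show "\<turnstile> \<phi>"
  proof (rule provable_csubst_Var[OF assms(2)])
    fix n assume n: "bounded_on (fv \<phi>) n (Var :: nat \<Rightarrow> ('c, 'f) tm)"
    have "wf (csubst n Var \<phi>)" using assms(2) by (simp add: wf_csubst)
    moreover from * have "interp algebra M (ground (tm_code \<circ> Var) \<phi>) \<in> designated algebra"
      unfolding holds_in_def M_def by (elim allE impE) auto
    ultimately show "\<turnstile> csubst n Var \<phi>"
      unfolding M_def interp_term_model[OF assms(2) wf n] by (simp add: val_designated)
  qed
qed

end

theorem corollary13p10:
  fixes \<Theta> :: "('c, 'f, 'p) signature"
    and \<Gamma> :: "('c, 'f, 'p) fm set"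
    and \<phi> :: "('c, 'f, 'p) fm"
  assumes "is_signature \<Theta>"
    and "\<Gamma> \<union> {\<phi>} \<subseteq> For \<Theta>"
    and "entails TYPE('u + ('c, 'f, 'p) fm) TYPE('b + ('c, 'f, 'p) fm set) \<Theta> \<Gamma> \<phi>"
  shows "derives \<Theta> \<Gamma> \<phi>"
proof -
  interpret lfi_theory \<Theta> \<Gamma> \<phi>
    using assms(2) by unfold_locales (auto simp: For_def)
  let ?A = "algebra :: ('b + ('c, 'f, 'p) fm set) gorder"
  let ?M = "term_model :: ('c, 'f, 'p, 'u + ('c, 'f, 'p) fm, 'b + ('c, 'f, 'p) fm set) struct"
  have "entails_in ?A ?M \<Gamma> \<phi>"
    using assms(3) lindenbaum.complete_boolean_completion is_struct_term_model
    unfolding entails_def by blast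
  moreover have "holds_in ?A ?M \<gamma>" if "\<gamma> \<in> \<Gamma>" for \<gamma>
    using that assms(2) holds_in_term_model[of \<gamma>] Premise[of \<gamma> \<Gamma> \<Theta>] by (auto simp: For_def)
  ultimately have "holds_in ?A ?M \<phi>" by (simp add: entails_in_def)
  then show ?thesis
    using assms(2) holds_in_term_model[of \<phi>] by (auto simp: For_def)
qed

end
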